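(* Let $\gamma>0$ and $\kappa\ge0$. For each $\tau>0$ let $\lambda_n^{(1)}=\lambda_n^{(2)}=\lambda_n$ and $\lambda_n^{(3)}$ be the Pauli eigenvalues of the discrete-time dynamics $\Lambda_n$ defined in the context, with $\varphi=e^{-2\gamma\tau}$, $\Delta=\tfrac12e^{-\kappa\tau}$ and any $p=p(\tau)$, $r=r(\tau)$, $p_0=p_0(\tau)$ satisfying the constraints $p_0,r\ge0$, $0\le\Delta\le p\le\tfrac12$, $p_0+2p+r=1$ (so that $p\to\tfrac12$, $r\to0$ as $\tau\to0$). Then in the stroboscopic limit $\tau\to0$, $n\to\infty$, $n\tau\to t$, one has $\lambda_n^{(3)}\to\lambda_t^{(3)}=e^{-2\gamma t}$ and $\lambda_n\to\lambda_t$, where $\lambda_t$ is the solution with $\lambda_{t=0}=1$ of $$\dot\lambda_t=-\gamma\lambda_t+\gamma^2\int_0^tds\,e^{-(\kappa+\gamma)(t-s)}\lambda_s,$$ namely $$\lambda_t=e^{-(\gamma+\frac\kappa2)t}\Big[\cosh(Kt)+\frac{\kappa}{2K}\sinh(Kt)\Big],\qquad K=\tfrac12\sqrt{\kappa^2+4\gamma^2}.$$ The Pauli maps $\Lambda_t$ on $M_2(\mathbb{C})$ defined by $\Lambda_t[\mathbb{1}]=\mathbb{1}$, $\Lambda_t[\sigma_j]=\lambda_t\sigma_j$ ($j=1,2$), $\Lambda_t[\sigma_3]=\lambda_t^{(3)}\sigma_3$ form a P-divisible family of completely positive trace-preserving maps satisfying $\dot\Lambda_t=\mathcal{L}_t\circ\Lambda_t$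 with $\mathcal{L}_t[\rho]=\tfrac12\sum_{i=1}^3\gamma_t^{(i)}(\sigma_i\rho\sigma_i-\rho)$ and rates $$\gamma_t^{(1)}=\gamma_t^{(2)}=\gamma,\qquad\gamma_t^{(3)}=-\frac{2\gamma^2}{\sqrt{\kappa^2+4\gamma^2}\,\coth\!\big(\tfrac12t\sqrt{\kappa^2+4\gamma^2}\big)+\kappa},$$ where $\gamma_t^{(3)}<0$ for all $t>0$ (and the value of $\gamma^{(3)}_t$ at $t=0$ is understood as the limit $0$).
   Context: $\sigma_1,\sigma_2,\sigma_3$ are the Pauli matrices, $\sigma_0=\mathbb{1}_2$. For given $\tau$, the maps $\phi_k$ on $M_2(\mathbb{C})$, $k=0,1,2,3$, are $\phi_k[\sigma_j]=\mu_k^{(j)}\sigma_j$ with $\mu_0^{(j)}=\mu_k^{(0)}=1$ and, for $j,k\in\{1,2,3\}$, $\mu_k^{(j)}=1$ if $j=k$ and $\mu_k^{(j)}=\varphi$ if $j\ne k$; equivalently $\phi_0=\mathrm{id}$ and $\phi_k=e^{\tau\mathcal{L}_k}$, $\mathcal{L}_k[X]=\gamma(\sigma_kX\sigma_k-X)$ for $k\ne0$. The transition matrix (rows and columns indexed by $0,1,2,3$) is $$T=\begin{pmatrix}p_0&p_0&p_0&p_0\\ p&p+\Delta&p-\Delta&p\\ p&p-\Delta&p+\Delta&p\\ r&r&r&r\end{pmatrix},$$ with invariant probability vector $(p_0,p,p,r)$, entries denoted $p_i$ (so $p_1=p_2=p$, $p_3=r$). Put $p_{i_1\cdots i_n}=T_{i_ni_{n-1}}\cdots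 T_{i_2i_1}p_{i_1}$ and $\Lambda_n=\sum_{i_1,\dots,i_n}p_{i_1\cdots i_n}\,\phi_{i_n}\circ\cdots\circ\phi_{i_1}$; then $\Lambda_n[\sigma_j]=\lambda_n^{(j)}\sigma_j$. A family $\{\Lambda_t\}_{t\ge0}$ is P-divisible if for all $t\ge s\ge0$ there is a positive trace-preserving map $\Lambda_{t,s}$ with $\Lambda_t=\Lambda_{t,s}\circ\Lambda_s$. *)

theory Defs
  imports "HOL-Analysis.Analysis"
begin

section \<open>Positive and completely positive maps on complex matrices\<close>

definition mat_scale :: "complex \<Rightarrow> complex^'n^'m \<Rightarrow> complex^'n^'m" where
  "mat_scale c A = (\<chi> i j. c * A $ i $ j)"

lemma vector_space_mat_scale: "vector_space mat_scale"
  by unfold_locales (auto simp: mat_scale_def vec_eq_iff algebra_simps)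

abbreviation mat_linear :: "(complex^'n^'n \<Rightarrow> complex^'n^'n) \<Rightarrow> bool" where
  "mat_linear \<equiv> Vector_Spaces.linear mat_scale mat_scale"

definition cvec_inner :: "complex^'n \<Rightarrow> complex^'n \<Rightarrow> complex" where
  "cvec_inner v w = (\<Sum>i\<in>UNIV. cnj (v $ i) * w $ i)"

definition pos_semidef :: "complex^'n^'n \<Rightarrow> bool" where
  "pos_semidef A \<longleftrightarrow> (\<forall>v. cvec_inner v (A *v v) \<in> \<real>\<^sub>\<ge>\<^sub>0)"

definition positive_map :: "(complex^'n^'n \<Rightarrow> complex^'n^'n) \<Rightarrow> bool" where
  "positive_map \<Phi> \<longleftrightarrow> mat_linear \<Phi> \<and> (\<forall>A. pos_semidef A \<longrightarrow> pos_semidef (\<Phi> A))"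

definition trace_preserving :: "(complex^'n^'n \<Rightarrow> complex^'n^'n) \<Rightarrow> bool" where
  "trace_preserving \<Phi> \<longleftrightarrow> (\<forall>A. trace (\<Phi> A) = trace A)"

text \<open>An \<open>m \<times> m\<close> block matrix with blocks \<open>A i j\<close>, \<open>i, j < m\<close>, represents an element of
  the tensor product of the \<open>m \<times> m\<close> matrices with the \<open>n \<times> n\<close> matrices. The size \<open>m\<close> is a
  natural number so that complete positivity can quantify over it.\<close>

definition block_pos_semidef :: "nat \<Rightarrow> (nat \<Rightarrow> nat \<Rightarrow> complex^'n^'n) \<Rightarrow> bool" where
  "block_pos_semidef m A \<longleftrightarrow>
     (\<forall>v. (\<Sum>i<m. \<Sum>j<m. cvec_inner (v i) (A i j *v v j)) \<in> \<real>\<^sub>\<ge>\<^sub>0)"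

definition completely_positive :: "(complex^'n^'n \<Rightarrow> complex^'n^'n) \<Rightarrow> bool" where
  "completely_positive \<Phi> \<longleftrightarrow> mat_linear \<Phi> \<and>
     (\<forall>m A. block_pos_semidef m A \<longrightarrow> block_pos_semidef m (\<lambda>i j. \<Phi> (A i j)))"

definition P_divisible :: "(real \<Rightarrow> complex^'n^'n \<Rightarrow> complex^'n^'n) \<Rightarrow> bool" where
  "P_divisible \<Lambda> \<longleftrightarrow> (\<forall>s t. 0 \<le> s \<and> s \<le> t \<longrightarrow>
     (\<exists>V. positive_map V \<and> trace_preserving V \<and> \<Lambda> t = V \<circ> \<Lambda> s))"

section \<open>Pauli maps\<close>

text \<open>Indices \<open>0, 1, 2, 3\<close> are natural numbers below 4; nothing is meant for larger ones.\<close>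

definition pauli :: "nat \<Rightarrow> complex^2^2" where
  "pauli k = [mat 1,
              vector [vector [0, 1], vector [1, 0]],
              vector [vector [0, -\<i>], vector [\<i>, 0]],
              vector [vector [1, 0], vector [0, -1]]] ! k"

text \<open>The linear map with \<open>\<sigma>\<^sub>j \<mapsto> \<mu> j \<sigma>\<^sub>j\<close>: the Pauli matrices are an orthogonal basis and
  \<open>X = (\<Sum>j<4. tr (\<sigma>\<^sub>j X) / 2 \<cdot> \<sigma>\<^sub>j)\<close>. The lemmas below confirm this.\<close>

definition pauli_map :: "(nat \<Rightarrow> real) \<Rightarrow> complex^2^2 \<Rightarrow> complex^2^2" where
  "pauli_map \<mu> X = (\<Sum>j<4. mat_scale (of_real (\<mu> j) * trace (pauli j ** X) / 2) (pauli j))"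

lemma mat_linear_pauli_map: "mat_linear (pauli_map \<mu>)"
proof -
  have "pauli_map \<mu> (X + Y) = pauli_map \<mu> X + pauli_map \<mu> Y" for X Y
    by (simp add: pauli_map_def mat_scale_def matrix_add_ldistrib trace_add vec_eq_iff
        sum.distrib[symmetric] field_simps)
  moreover have "trace (A ** mat_scale c X) = c * trace (A ** X)" for A X :: "complex^2^2" and c
    by (simp add: trace_def matrix_matrix_mult_def mat_scale_def sum_distrib_left ac_simps)
  then have "pauli_map \<mu> (mat_scale c X) = mat_scale c (pauli_map \<mu> X)" for c X
    by (simp add: pauli_map_def mat_scale_def vec_eq_iff sum_distrib_left field_simps)
  ultimately show ?thesis
    by (auto simp: Vector_Spaces.linear_iff vector_space_pair_def vector_space_mat_scale)
qed

lemma trace_pauli_mult_pauli: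
  assumes "i < 4" "j < 4"
  shows "trace (pauli i ** pauli j) = (if i = j then 2 else 0)"
proof -
  have *: "k = 0 \<or> k = 1 \<or> k = 2 \<or> k = 3" if "k < 4" for k :: nat using that by linarith
  show ?thesis
    using *[OF assms(1)] *[OF assms(2)]
    by (elim disjE; simp add: pauli_def trace_def matrix_matrix_mult_def mat_def sum_2)
qed

lemma pauli_map_pauli:
  assumes "j < 4"
  shows "pauli_map \<mu> (pauli j) = \<mu> j *\<^sub>R pauli j"
proof -
  have "pauli_map \<mu> (pauli j) = (\<Sum>i<4. if i = j then \<mu> j *\<^sub>R pauli j else 0)"
    unfolding pauli_map_def
    by (intro sum.cong refl)
      (auto simp: trace_pauli_mult_pauli assms mat_scale_def vec_eq_iff scaleR_conv_of_real[where 'a = complex])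
  then show ?thesis
    using assms by simp
qed

definition pauli_eigenvalue :: "(complex^2^2 \<Rightarrow> complex^2^2) \<Rightarrow> nat \<Rightarrow> real" where
  "pauli_eigenvalue \<Phi> j = (THE c. \<Phi> (pauli j) = c *\<^sub>R pauli j)"

section \<open>The discrete-time dynamics\<close>

definition noise_map :: "real \<Rightarrow> nat \<Rightarrow> complex^2^2 \<Rightarrow> complex^2^2" where
  "noise_map \<phi> k = pauli_map (\<lambda>j. if j = 0 \<or> k = 0 \<or> j = k then 1 else \<phi>)"

definition transition_matrix :: "real \<Rightarrow> real \<Rightarrow> real \<Rightarrow> real \<Rightarrow> nat \<Rightarrow> nat \<Rightarrow> real" where
  "transition_matrix \<Delta> p\<^sub>0 p r i j =
     [[p\<^sub>0, p\<^sub>0, p\<^sub>0, p\<^sub>0],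
      [p, p + \<Delta>, p - \<Delta>, p],
      [p, p - \<Delta>, p + \<Delta>, p],
      [r, r, r, r]] ! i ! j"

text \<open>A word \<open>w = [i\<^sub>1, \<dots>, i\<^sub>n]\<close> lists the indices in chronological order. The empty word has
  probability 1, so that the dynamics is the identity at \<open>n = 0\<close>.\<close>

definition path_probability :: "real \<Rightarrow> real \<Rightarrow> real \<Rightarrow> real \<Rightarrow> nat list \<Rightarrow> real" where
  "path_probability \<Delta> p\<^sub>0 p r w =
     (if w = [] then 1 else [p\<^sub>0, p, p, r] ! hd w) *
     (\<Prod>k<length w - 1. transition_matrix \<Delta> p\<^sub>0 p r (w ! Suc k) (w ! k))"

definition discrete_dynamics ::
    "real \<Rightarrow> real \<Rightarrow> real \<Rightarrow> real \<Rightarrow> real \<Rightarrow> nat \<Rightarrow> complex^2^2 \<Rightarrow> complex^2^2" where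
  "discrete_dynamics \<phi> \<Delta> p\<^sub>0 p r n X =
     (\<Sum>w | set w \<subseteq> {..<4} \<and> length w = n.
        path_probability \<Delta> p\<^sub>0 p r w *\<^sub>R fold (noise_map \<phi>) w X)"

section \<open>The continuous-time limit\<close>

definition limit_eigenvalue :: "real \<Rightarrow> real \<Rightarrow> real \<Rightarrow> real" where
  "limit_eigenvalue \<gamma> \<kappa> t = (let K = sqrt (\<kappa>\<^sup>2 + 4 * \<gamma>\<^sup>2) / 2 in
     exp (- (\<gamma> + \<kappa> / 2) * t) * (cosh (K * t) + \<kappa> / (2 * K) * sinh (K * t)))"

definition solves_memory_equation :: "real \<Rightarrow> real \<Rightarrow> (real \<Rightarrow> real) \<Rightarrow> bool" where
  "solves_memory_equation \<gamma> \<kappa> f \<longleftrightarrow> f 0 = 1 \<and>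
     (\<forall>t\<ge>0. (f has_real_derivative
        - \<gamma> * f t + \<gamma>\<^sup>2 * integral {0..t} (\<lambda>s. exp (- (\<kappa> + \<gamma>) * (t - s)) * f s)) (at t within {0..}))"

definition limit_dynamics :: "real \<Rightarrow> real \<Rightarrow> real \<Rightarrow> complex^2^2 \<Rightarrow> complex^2^2" where
  "limit_dynamics \<gamma> \<kappa> t = pauli_map (\<lambda>j. [1, limit_eigenvalue \<gamma> \<kappa> t,
     limit_eigenvalue \<gamma> \<kappa> t, exp (- 2 * \<gamma> * t)] ! j)"

definition coth :: "real \<Rightarrow> real" where
  "coth x = cosh x / sinh x"

text \<open>The value at \<open>t = 0\<close> is the limit, since \<open>coth 0 = 0\<close> here by the convention for division
  by zero.\<close>

definition third_rate :: "real \<Rightarrow> real \<Rightarrow> real \<Rightarrow> real" where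
  "third_rate \<gamma> \<kappa> t = (if t = 0 then 0 else
     - (2 * \<gamma>\<^sup>2) / (sqrt (\<kappa>\<^sup>2 + 4 * \<gamma>\<^sup>2) * coth (t * sqrt (\<kappa>\<^sup>2 + 4 * \<gamma>\<^sup>2) / 2) + \<kappa>))"

definition rate :: "real \<Rightarrow> real \<Rightarrow> nat \<Rightarrow> real \<Rightarrow> real" where
  "rate \<gamma> \<kappa> i t = (if i = 3 then third_rate \<gamma> \<kappa> t else \<gamma>)"

definition pauli_generator :: "(nat \<Rightarrow> real) \<Rightarrow> complex^2^2 \<Rightarrow> complex^2^2" where
  "pauli_generator g \<rho> = (1 / 2) *\<^sub>R (\<Sum>i=1..3. g i *\<^sub>R (pauli i ** \<rho> ** pauli i - \<rho>))"

end

theory Submission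
  imports Defs "HOL-Real_Asymp.Real_Asymp"
begin

text \<open>Summing over words by their first letter turns the eigenvalue \<open>\<lambda>\<^sub>n\<close> into the first component of
  \<open>(S\<^sub>n, E\<^sub>n) = M\<^sup>n (1, 0)\<close> for a \<open>2 \<times> 2\<close> matrix \<open>M\<close> depending on \<open>\<tau>\<close>, where \<open>S\<close> starts
  the chain at 0 and \<open>S + E\<close>, \<open>S - E\<close> start it at 1 and 2. With its eigenvalues \<open>1 + c\<^sub>\<plusminus> \<tau> + o(\<tau>)\<close>,
  the closed form of \<open>S\<^sub>n\<close> converges to \<open>\<lambda>\<^sub>t\<close>. In continuous time \<open>\<lambda>\<close> and the memory integral
  \<open>D\<^sub>t = \<gamma> \<integral> e\<^bsup>-(\<kappa>+\<gamma>)(t-s)\<^esup> \<lambda>\<^sub>s ds\<close> solve \<open>\<lambda>' = -\<gamma> \<lambda> + \<gamma> D\<close>, \<open>D' = \<gamma> \<lambda> - (\<kappa> + \<gamma>) D\<close>. This system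
  yields uniqueness (the energy of a difference of solutions decreases), complete positivity
  (\<open>2 \<lambda>\<^sub>t \<le> 1 + e\<^bsup>-2\<gamma>t\<^esup>\<close> follows from \<open>\<lambda> + D \<le> 1\<close>), P-divisibility (\<open>\<lambda>\<close> decreases because
  \<open>D \<le> \<lambda>\<close>, and a Pauli map is positive once its multipliers lie in \<open>[-1, 1]\<close>) and the third
  rate, which is \<open>-\<gamma> D / \<lambda>\<close>.\<close>

section \<open>Positivity of Pauli maps\<close>

lemma lessThan_4_sum: "(\<Sum>j<4. f j) = f 0 + f 1 + f 2 + f (3::nat)" for f :: "nat \<Rightarrow> 'a::comm_monoid_add"
  by (simp add: eval_nat_numeral)

lemma pauli_entries:
  "pauli 0 $ 1 $ 1 = 1" "pauli 0 $ 1 $ 2 = 0" "pauli 0 $ 2 $ 1 = 0" "pauli 0 $ 2 $ 2 = 1"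
  "pauli 1 $ 1 $ 1 = 0" "pauli 1 $ 1 $ 2 = 1" "pauli 1 $ 2 $ 1 = 1" "pauli 1 $ 2 $ 2 = 0"
  "pauli 2 $ 1 $ 1 = 0" "pauli 2 $ 1 $ 2 = - \<i>" "pauli 2 $ 2 $ 1 = \<i>" "pauli 2 $ 2 $ 2 = 0"
  "pauli 3 $ 1 $ 1 = 1" "pauli 3 $ 1 $ 2 = 0" "pauli 3 $ 2 $ 1 = 0" "pauli 3 $ 2 $ 2 = -1"
  by (simp_all add: pauli_def mat_def)

lemma matrix_2_eq_iff:
  fixes A B :: "'a^2^2"
  shows "A = B \<longleftrightarrow> A $ 1 $ 1 = B $ 1 $ 1 \<and> A $ 1 $ 2 = B $ 1 $ 2 \<and> A $ 2 $ 1 = B $ 2 $ 1 \<and> A $ 2 $ 2 = B $ 2 $ 2"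
  by (auto simp: vec_eq_iff forall_2)

lemma pauli_map_entries:
  "pauli_map \<mu> X $ 1 $ 1 = (\<mu> 0 * (X $ 1 $ 1 + X $ 2 $ 2) + \<mu> 3 * (X $ 1 $ 1 - X $ 2 $ 2)) / 2"
  "pauli_map \<mu> X $ 1 $ 2 = (\<mu> 1 * (X $ 1 $ 2 + X $ 2 $ 1) + \<mu> 2 * (X $ 1 $ 2 - X $ 2 $ 1)) / 2"
  "pauli_map \<mu> X $ 2 $ 1 = (\<mu> 1 * (X $ 1 $ 2 + X $ 2 $ 1) - \<mu> 2 * (X $ 1 $ 2 - X $ 2 $ 1)) / 2"
  "pauli_map \<mu> X $ 2 $ 2 = (\<mu> 0 * (X $ 1 $ 1 + X $ 2 $ 2) - \<mu> 3 * (X $ 1 $ 1 - X $ 2 $ 2)) / 2"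
  by (simp_all add: pauli_map_def lessThan_4_sum mat_scale_def trace_def matrix_matrix_mult_def
      sum_2 pauli_entries algebra_simps add_divide_distrib diff_divide_distrib
      del: One_nat_def)

lemma pauli_conjugation_entries:
  "(pauli k ** X ** pauli k) $ i $ j = (\<Sum>l\<in>UNIV. (\<Sum>m\<in>UNIV. pauli k $ i $ m * X $ m $ l) * pauli k $ l $ j)"
  by (simp add: matrix_matrix_mult_def)

text \<open>The weights come from inverting the table of signs with which conjugation by
  \<open>pauli k\<close> acts on \<open>pauli j\<close>: plus if the two commute, minus if they
  anticommute.\<close>

definition pauli_weight :: "(nat \<Rightarrow> real) \<Rightarrow> nat \<Rightarrow> real" where
  "pauli_weight \<mu> k = [\<mu> 0 + \<mu> 1 + \<mu> 2 + \<mu> 3, \<mu> 0 + \<mu> 1 - \<mu> 2 - \<mu> 3,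
     \<mu> 0 - \<mu> 1 + \<mu> 2 - \<mu> 3, \<mu> 0 - \<mu> 1 - \<mu> 2 + \<mu> 3] ! k / 4"

lemma pauli_map_Kraus:
  "pauli_map \<mu> X = (\<Sum>k<4. pauli_weight \<mu> k *\<^sub>R (pauli k ** X ** pauli k))"
  unfolding matrix_2_eq_iff
  by (simp add: pauli_map_entries lessThan_4_sum pauli_conjugation_entries sum_2 pauli_entries
      pauli_weight_def scaleR_conv_of_real[where 'a = complex] field_simps del: One_nat_def)

text \<open>\<open>pauli 2\<close> is antisymmetric and the other three Pauli matrices are
  symmetric, so transposition is itself a Pauli map.\<close>

lemma pauli_map_transpose:
  "pauli_map \<mu> (transpose X) = pauli_map (\<lambda>j. if j = 2 then - \<mu> j else \<mu> j) X"
  by (simp add: matrix_2_eq_iff pauli_map_entries transpose_def algebra_simps)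

lemma pauli_map_compose: "pauli_map \<mu> (pauli_map \<nu> X) = pauli_map (\<lambda>j. \<mu> j * \<nu> j) X"
  by (simp add: matrix_2_eq_iff pauli_map_entries field_simps)

lemma trace_preserving_pauli_map:
  assumes "\<mu> 0 = 1"
  shows "trace_preserving (pauli_map \<mu>)"
  using assms by (simp add: trace_preserving_def trace_def sum_2 pauli_map_entries field_simps)

text \<open>Pauli matrices are Hermitian, so the left factor moves to the other argument of the
  inner product.\<close>

lemma cvec_inner_pauli:
  assumes "k < 4"
  shows "cvec_inner v ((pauli k ** A ** pauli k) *v w) = cvec_inner (pauli k *v v) (A *v (pauli k *v w))"
proof -
  have "k = 0 \<or> k = 1 \<or> k = 2 \<or> k = 3" using assms by linarith
  then show ?thesis
    by (elim disjE) (simp_all add: cvec_inner_def sum_2 matrix_vector_mult_def pauli_conjugation_entries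
      pauli_entries algebra_simps del: One_nat_def)
qed

lemma matrix_vector_mult_scaleR_sum:
  "(\<Sum>k\<in>K. c k *\<^sub>R A k) *v v = (\<Sum>k\<in>K. c k *\<^sub>R (A k *v v))" for A :: "'k \<Rightarrow> complex^'n^'m"
  by (simp add: vec_eq_iff matrix_vector_mult_def scaleR_sum_right sum_distrib_right
    sum.swap[of _ K])

lemma cvec_inner_scaleR_sum:
  "cvec_inner v (\<Sum>k\<in>K. c k *\<^sub>R w k) = (\<Sum>k\<in>K. of_real (c k) * cvec_inner v (w k))"
  by (simp add: cvec_inner_def sum_distrib_left scaleR_conv_of_real[where 'a = complex]
    sum.swap[of _ K] ac_simps)

lemma sum_nonneg_Reals:
  assumes "\<And>x. x \<in> S \<Longrightarrow> f x \<in> \<real>\<^sub>\<ge>\<^sub>0"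
  shows "sum f S \<in> \<real>\<^sub>\<ge>\<^sub>0"
  using assms by (induction S rule: infinite_finite_induct) auto

text \<open>In the Kraus form, each conjugation moves \<open>pauli k\<close> onto the test vectors,
  where the hypothesis on the block matrix applies again. Nonnegative weights keep the sum
  nonnegative.\<close>

lemma completely_positive_pauli_map:
  assumes "\<And>k. k < 4 \<Longrightarrow> pauli_weight \<mu> k \<ge> 0"
  shows "completely_positive (pauli_map \<mu>)"
proof -
  have "(\<Sum>i<m. \<Sum>j<m. cvec_inner (v i) (pauli_map \<mu> (A i j) *v v j)) \<in> \<real>\<^sub>\<ge>\<^sub>0"
    if A: "block_pos_semidef m A" for m A and v :: "nat \<Rightarrow> complex^2"
  proof -
    have "(\<Sum>i<m. \<Sum>j<m. cvec_inner (v i) (pauli_map \<mu> (A i j) *v v j)) =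
      (\<Sum>i<m. \<Sum>j<m. \<Sum>k<4. of_real (pauli_weight \<mu> k) *
         cvec_inner (pauli k *v v i) (A i j *v (pauli k *v v j)))"
      by (simp add: pauli_map_Kraus matrix_vector_mult_scaleR_sum cvec_inner_scaleR_sum cvec_inner_pauli)
    also have "\<dots> = (\<Sum>k<4. of_real (pauli_weight \<mu> k) *
         (\<Sum>i<m. \<Sum>j<m. cvec_inner (pauli k *v v i) (A i j *v (pauli k *v v j))))"
      by (simp only: sum_distrib_left sum.swap[of _ "{..<4}"])
    also have "\<dots> \<in> \<real>\<^sub>\<ge>\<^sub>0"
    proof (rule sum_nonneg_Reals, rule nonneg_Reals_mult_I)
      show "(\<Sum>i<m. \<Sum>j<m. cvec_inner (pauli k *v v i) (A i j *v (pauli k *v v j))) \<in> \<real>\<^sub>\<ge>\<^sub>0" for k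
        using A[unfolded block_pos_semidef_def, rule_format, of "\<lambda>i. pauli k *v v i"] .
    qed (use assms in auto)
    finally show ?thesis .
  qed
  then show ?thesis
    by (auto simp: completely_positive_def mat_linear_pauli_map block_pos_semidef_def)
qed

lemma completely_positive_imp_pos_semidef:
  assumes "completely_positive \<Phi>" "pos_semidef A"
  shows "pos_semidef (\<Phi> A)"
proof -
  have "block_pos_semidef 1 (\<lambda>i j. A)"
    using assms(2) by (auto simp: block_pos_semidef_def pos_semidef_def)
  then have "block_pos_semidef 1 (\<lambda>i j. \<Phi> A)"
    using assms(1) by (auto simp: completely_positive_def)
  then have "(\<Sum>i<1::nat. \<Sum>j<1::nat. cvec_inner ((\<lambda>_. v) i) (\<Phi> A *v (\<lambda>_. v) j)) \<in> \<real>\<^sub>\<ge>\<^sub>0" for v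
    unfolding block_pos_semidef_def by (rule allE[where x = "\<lambda>_. v"])
  then show ?thesis
    by (simp add: pos_semidef_def)
qed

text \<open>The quadratic form of the transpose at \<open>v\<close> is the form of the matrix at the
  complex conjugate of \<open>v\<close>.\<close>

lemma pos_semidef_transpose:
  assumes "pos_semidef A"
  shows "pos_semidef (transpose A)"
proof -
  have "cvec_inner v (transpose A *v v) = cvec_inner (\<chi> i. cnj (v $ i)) (A *v (\<chi> i. cnj (v $ i)))" for v
    unfolding cvec_inner_def matrix_vector_mult_def transpose_def
    by (simp add: sum_distrib_left, subst sum.swap, simp add: ac_simps)
  then show ?thesis
    using assms by (simp add: pos_semidef_def)
qed

lemma pos_semidef_add:
  assumes "pos_semidef A" "pos_semidef B"
  shows "pos_semidef (A + B)"
proof -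
  have "cvec_inner v ((A + B) *v v) = cvec_inner v (A *v v) + cvec_inner v (B *v v)" for v
    by (simp add: cvec_inner_def matrix_vector_mult_add_rdistrib sum.distrib distrib_left)
  then show ?thesis
    using assms by (simp add: pos_semidef_def)
qed

text \<open>Such a map sends the Bloch ball into itself. The lemma serves P-divisibility, where the
  intermediate maps have to be positive only.\<close>

lemma pos_semidef_pauli_map:
  assumes "\<mu> 0 = 1" "\<And>j. j \<in> {1,2,3} \<Longrightarrow> \<bar>\<mu> j\<bar> \<le> 1" "pos_semidef A"
  shows "pos_semidef (pauli_map \<mu> A)"
proof -
  define a b c where abc: "a = \<mu> 1" "b = \<mu> 2" "c = \<mu> 3"
  have bounds: "1 + a \<ge> 0" "1 - a \<ge> 0" "1 + b \<ge> 0" "1 - b \<ge> 0" "1 + c \<ge> 0" "1 - c \<ge> 0"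
    using assms(2)[of 1] assms(2)[of 2] assms(2)[of 3] unfolding abc by auto
  \<comment> \<open>The cube of multipliers \<open>(a, b, c)\<close> is the convex hull of its eight vertices: the even ones are
    the conjugations by Pauli matrices, the odd ones the same composed with the transposition.
    \<open>\<alpha>\<close> and \<open>\<beta>\<close> collect the two halves of the convex combination with product weights.\<close>
  define \<alpha> \<beta> where
    "\<alpha> = (\<lambda>j. [(1 + a * b * c) / 2, (a + b * c) / 2, (b + a * c) / 2, (c + a * b) / 2] ! j)" and
    "\<beta> = (\<lambda>j. [(1 - a * b * c) / 2, (a - b * c) / 2, - (b - a * c) / 2, (c - a * b) / 2] ! j)"
  \<comment> \<open>The minus sign in the third entry of \<beta> cancels the one produced by
    transposition, so the multipliers add up to \<open>(1, a, b, c)\<close>.\<close>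
  have "pauli_map \<mu> A = pauli_map \<alpha> A + pauli_map \<beta> (transpose A)"
    unfolding matrix_2_eq_iff pauli_map_transpose
    using assms(1)
    by (simp add: pauli_map_entries \<alpha>_def \<beta>_def abc[symmetric] field_simps del: One_nat_def)
  moreover have "completely_positive (pauli_map \<alpha>)"
  proof (rule completely_positive_pauli_map)
    fix k :: nat assume "k < 4"
    then have "k = 0 \<or> k = 1 \<or> k = 2 \<or> k = 3" by linarith
    \<comment> \<open>Each weight is the product weight of one even vertex: (1,1,1), (1,-1,-1),
      (-1,1,-1), (-1,-1,1).\<close>
    moreover have "pauli_weight \<alpha> 0 = (1 + a) * (1 + b) * (1 + c) / 8"
      "pauli_weight \<alpha> 1 = (1 + a) * (1 - b) * (1 - c) / 8"
      "pauli_weight \<alpha> 2 = (1 - a) * (1 + b) * (1 - c) / 8"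
      "pauli_weight \<alpha> 3 = (1 - a) * (1 - b) * (1 + c) / 8"
      by (simp_all add: pauli_weight_def \<alpha>_def field_simps)
    ultimately show "pauli_weight \<alpha> k \<ge> 0"
      by (elim disjE) (simp_all only: bounds mult_nonneg_nonneg divide_nonneg_nonneg zero_le_numeral)
  qed
  moreover have "completely_positive (pauli_map \<beta>)"
  proof (rule completely_positive_pauli_map)
    fix k :: nat assume "k < 4"
    then have "k = 0 \<or> k = 1 \<or> k = 2 \<or> k = 3" by linarith
    \<comment> \<open>Transposition flips the second coordinate of each even vertex, which yields
      the odd vertices.\<close>
    moreover have "pauli_weight \<beta> 0 = (1 + a) * (1 - b) * (1 + c) / 8"
      "pauli_weight \<beta> 1 = (1 + a) * (1 + b) * (1 - c) / 8"
      "pauli_weight \<beta> 2 = (1 - a) * (1 - b) * (1 - c) / 8"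
      "pauli_weight \<beta> 3 = (1 - a) * (1 + b) * (1 + c) / 8"
      by (simp_all add: pauli_weight_def \<beta>_def field_simps)
    ultimately show "pauli_weight \<beta> k \<ge> 0"
      by (elim disjE) (simp_all only: bounds mult_nonneg_nonneg divide_nonneg_nonneg zero_le_numeral)
  qed
  ultimately show ?thesis
    using assms(3) by (auto intro: pos_semidef_add completely_positive_imp_pos_semidef pos_semidef_transpose)
qed

section \<open>The discrete-time eigenvalues\<close>

primrec transition_weight :: "(nat \<Rightarrow> nat \<Rightarrow> real) \<Rightarrow> nat \<Rightarrow> nat list \<Rightarrow> real" where
  "transition_weight T a [] = 1"
| "transition_weight T a (b # w) = T b a * transition_weight T b w"

lemma transition_weight_eq_prod:
  "transition_weight T a w = (\<Prod>k<length w. T (w ! k) ((a # w) ! k))"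
  by (induction w arbitrary: a) (simp_all add: prod.lessThan_Suc_shift del: prod.lessThan_Suc)

text \<open>Column 0 of the transition matrix is the initial distribution. A fictitious letter 0 in
  front of the word therefore makes the first letter an ordinary transition.\<close>

lemma path_probability_eq_transition_weight:
  assumes "set w \<subseteq> {..<4}"
  shows "path_probability \<Delta> p0 p r w = transition_weight (transition_matrix \<Delta> p0 p r) 0 w"
proof (cases w)
  case (Cons b v)
  then have "b < 4" using assms by auto
  then have "b = 0 \<or> b = 1 \<or> b = 2 \<or> b = 3" by linarith
  then have "[p0, p, p, r] ! b = transition_matrix \<Delta> p0 p r b 0"
    by (auto simp: transition_matrix_def)
  then show ?thesis
    by (simp add: Cons path_probability_def transition_weight_eq_prod prod.lessThan_Suc_shift
      del: prod.lessThan_Suc)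
qed (simp add: path_probability_def)

text \<open>For a stochastic \<open>T\<close> this is the expected product of the factors
  \<open>m\<close> over the next \<open>n\<close> letters, given the current letter
  \<open>a\<close>. A variable start is what makes the recursion on \<open>n\<close> close.\<close>

definition weight_sum :: "(nat \<Rightarrow> nat \<Rightarrow> real) \<Rightarrow> (nat \<Rightarrow> real) \<Rightarrow> nat \<Rightarrow> nat \<Rightarrow> real" where
  "weight_sum T m n a =
     (\<Sum>w | set w \<subseteq> {..<4} \<and> length w = n. transition_weight T a w * (\<Prod>k\<leftarrow>w. m k))"

lemma weight_sum_0: "weight_sum T m 0 a = 1"
proof -
  have "{w. set w \<subseteq> {..<4::nat} \<and> length w = 0} = {[]}" by auto
  then show ?thesis by (simp add: weight_sum_def)
qed

text \<open>The sum is split by the first letter \<open>b\<close>, which becomes the starting letter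
  for the rest of the word.\<close>

lemma weight_sum_Suc: "weight_sum T m (Suc n) a = (\<Sum>b<4. T b a * m b * weight_sum T m n b)"
proof -
  let ?W = "\<lambda>n. {w. set w \<subseteq> {..<4::nat} \<and> length w = n}"
  have "weight_sum T m (Suc n) a =
      (\<Sum>(w, b) \<in> ?W n \<times> {..<4}. transition_weight T a (b # w) * (\<Prod>k\<leftarrow>b # w. m k))"
    unfolding weight_sum_def lists_length_Suc_eq
    by (subst sum.reindex) (auto simp: inj_on_def case_prod_unfold)
  also have "\<dots> = (\<Sum>b<4. \<Sum>w\<in>?W n. transition_weight T a (b # w) * (\<Prod>k\<leftarrow>b # w. m k))"
    by (subst sum.cartesian_product[symmetric], rule sum.swap)
  finally show ?thesis
    by (simp add: weight_sum_def sum_distrib_left ac_simps)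
qed

section \<open>Eigenvalues on the Pauli basis\<close>

definition noise_factor :: "real \<Rightarrow> nat \<Rightarrow> nat \<Rightarrow> real" where
  "noise_factor \<phi> j k = (if j = 0 \<or> k = 0 \<or> j = k then 1 else \<phi>)"

lemma fold_noise_map_pauli:
  assumes "j < 4"
  shows "fold (noise_map \<phi>) w (c *\<^sub>R pauli j) = (c * (\<Prod>k\<leftarrow>w. noise_factor \<phi> j k)) *\<^sub>R pauli j"
proof (induction w arbitrary: c)
  case (Cons k w)
  have "pauli_map \<mu> (c *\<^sub>R X) = c *\<^sub>R pauli_map \<mu> X" for \<mu> X
    by (simp add: matrix_2_eq_iff pauli_map_entries scaleR_conv_of_real[where 'a = complex] field_simps)
  then have "noise_map \<phi> k (c *\<^sub>R pauli j) = (c * noise_factor \<phi> j k) *\<^sub>R pauli j"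
    using pauli_map_pauli[OF assms] by (simp add: noise_map_def noise_factor_def)
  then show ?case
    using Cons.IH[of "c * noise_factor \<phi> j k"] by (simp add: ac_simps)
qed simp

lemma discrete_dynamics_pauli:
  assumes "j < 4"
  shows "discrete_dynamics \<phi> \<Delta> p0 p r n (pauli j) =
    weight_sum (transition_matrix \<Delta> p0 p r) (noise_factor \<phi> j) n 0 *\<^sub>R pauli j"
  using fold_noise_map_pauli[OF assms, where c = 1]
  by (simp add: discrete_dynamics_def weight_sum_def path_probability_eq_transition_weight scaleR_sum_left)

lemma pauli_nonzero: "j < 4 \<Longrightarrow> pauli j \<noteq> 0"
  using trace_pauli_mult_pauli[of j j] by (auto simp: trace_def matrix_matrix_mult_def)

text \<open>The eigenvector is nonzero, so the definite description has only one witness.\<close>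

lemma pauli_eigenvalue_eq:
  assumes "\<Phi> (pauli j) = c *\<^sub>R pauli j" "j < 4"
  shows "pauli_eigenvalue \<Phi> j = c"
  unfolding pauli_eigenvalue_def assms(1) using pauli_nonzero[OF assms(2)] by simp

text \<open>Columns 0 and 3 of the transition matrix agree.\<close>

lemma weight_sum_start_3:
  "weight_sum (transition_matrix \<Delta> p0 p r) m n 3 = weight_sum (transition_matrix \<Delta> p0 p r) m n 0"
  by (cases n) (simp_all add: weight_sum_0 weight_sum_Suc lessThan_4_sum transition_matrix_def)

text \<open>The letters 1 and 2 carry the same factor \<phi> here, and \<Delta> cancels from the sum
  of columns 1 and 2. Hence the starts 1 and 2 average to the start 0, and the recursion becomes
  scalar.\<close>

lemma weight_sum_third:
  "weight_sum (transition_matrix \<Delta> p0 p r) (noise_factor \<phi> 3) n 0 = (p0 + 2 * p * \<phi> + r) ^ n"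
proof -
  define F where "F = weight_sum (transition_matrix \<Delta> p0 p r) (noise_factor \<phi> 3)"
  note rec = weight_sum_Suc[of "transition_matrix \<Delta> p0 p r" "noise_factor \<phi> 3", folded F_def]
  have start: "F n 3 = F n 0" "F 0 a = 1" for n a
    by (simp_all add: F_def weight_sum_start_3 weight_sum_0)
  have "F n 0 = (p0 + 2 * p * \<phi> + r) ^ n \<and> F n 1 + F n 2 = 2 * F n 0"
  proof (induction n)
    case (Suc n)
    have *: "F n 2 = 2 * F n 0 - F n 1" using Suc.IH by simp
    show ?case
      using Suc.IH unfolding rec lessThan_4_sum * start
      by (simp add: transition_matrix_def noise_factor_def algebra_simps)
  qed (simp add: start)
  then show ?thesis by (simp add: F_def)
qed

text \<open>The numbers \<open>(a + d + q) / 2\<close> and \<open>(a + d - q) / 2\<close> are the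
  eigenvalues of the matrix with rows \<open>(a, b)\<close> and \<open>(c, d)\<close>, and
  \<open>q\<close> is their gap.\<close>

lemma coupled_recursion_closed_form:
  fixes S E :: "nat \<Rightarrow> real" and a b c d q :: real
  assumes "S 0 = 1" "E 0 = 0" "\<And>n. S (Suc n) = a * S n + b * E n" "\<And>n. E (Suc n) = c * S n + d * E n"
    and q: "q > 0" "q\<^sup>2 = (a - d)\<^sup>2 + 4 * (b * c)"
  shows "S n = ((a - (a + d - q) / 2) * ((a + d + q) / 2) ^ n
    + ((a + d + q) / 2 - a) * ((a + d - q) / 2) ^ n) / q"
proof -
  define l k where "l = (a + d + q) / 2" and "k = (a + d - q) / 2"
  have lk: "(a - k) * (l - a) = b * c" "l - k = q"
    using q(2) unfolding l_def k_def by (simp_all add: power2_eq_square field_simps)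
  have l': "a - k = l - d" "l - a = d - k" unfolding l_def k_def by (simp_all add: field_simps)
  \<comment> \<open>The formula for \<open>E\<close> is carried along because the recursion for
    \<open>S\<close> needs it; the factor \<open>q\<close> avoids division. The characteristic
    equation enters as \<open>(a - k) * (l - a) = b * c\<close>.\<close>
  have "q * S n = (a - k) * l ^ n + (l - a) * k ^ n \<and> q * E n = c * (l ^ n - k ^ n)"
  proof (induction n)
    case 0
    then show ?case using assms(1,2) lk(2) by simp
  next
    case (Suc n)
    have "q * S (Suc n) = a * (q * S n) + b * (q * E n)"
      by (simp add: assms(3) algebra_simps)
    also have "\<dots> = a * ((a - k) * l ^ n + (l - a) * k ^ n) + (b * c) * (l ^ n - k ^ n)"
      by (simp add: Suc.IH)
    also have "\<dots> = (a - k) * l ^ Suc n + (l - a) * k ^ Suc n"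
      unfolding lk(1)[symmetric] by (simp add: algebra_simps)
    finally have S: "q * S (Suc n) = (a - k) * l ^ Suc n + (l - a) * k ^ Suc n" .
    have "q * E (Suc n) = c * (q * S n) + d * (q * E n)"
      by (simp add: assms(4) algebra_simps)
    also have "\<dots> = c * ((l - d) * l ^ n + (d - k) * k ^ n) + d * (c * (l ^ n - k ^ n))"
      unfolding l'[symmetric] by (simp add: Suc.IH)
    also have "\<dots> = c * (l ^ Suc n - k ^ Suc n)"
      by (simp add: algebra_simps)
    finally show ?case using S by simp
  qed
  then show ?thesis
    using q(1) unfolding l_def k_def by (simp add: field_simps)
qed

text \<open>The starts 0, 1, 2 reduce to \<open>S\<close> and \<open>S + E\<close>,
  \<open>S - E\<close>, which obey a coupled recursion with diagonal \<open>a\<close>,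
  \<open>d\<close>. Its off-diagonal entries enter the closed form for \<open>S\<close> only through
  their product, so the result is the same for both directions.\<close>

lemma weight_sum_transverse:
  fixes n :: nat
  assumes "j = 1 \<or> j = 2"
    and "p0 + 2 * p + r = 1" "p > 0" "\<Delta> > 0" "\<phi> < 1"
  defines "a \<equiv> 1 - (1 - \<phi>) * (p + r)" and "d \<equiv> \<Delta> * (1 + \<phi>)"
  defines "q \<equiv> sqrt ((a - d)\<^sup>2 + 4 * p * \<Delta> * (1 - \<phi>)\<^sup>2)"
  shows "weight_sum (transition_matrix \<Delta> p0 p r) (noise_factor \<phi> j) n 0 =
    ((a - (a + d - q) / 2) * ((a + d + q) / 2) ^ n
      + ((a + d + q) / 2 - a) * ((a + d - q) / 2) ^ n) / q"
proof -
  define F where "F = weight_sum (transition_matrix \<Delta> p0 p r) (noise_factor \<phi> j)"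
  note rec = weight_sum_Suc[of "transition_matrix \<Delta> p0 p r" "noise_factor \<phi> j", folded F_def]
  have start: "F n 3 = F n 0" "F 0 a = 1" for n a
    by (simp_all add: F_def weight_sum_start_3 weight_sum_0)
  \<comment> \<open>exchanging the roles of the directions 1 and 2 changes the sign of \<open>E\<close> only\<close>
  define e :: real where "e = (if j = 1 then 1 else -1)"
  have e: "e * e = 1" by (simp add: e_def)
  define E where "E n = F n 1 - F n 0" for n
  \<comment> \<open>Column 0 is the average of columns 1 and 2; at length 0 all starts give
    1.\<close>
  have F2: "F n 2 = F n 0 - E n" for n
    unfolding E_def by (cases n) (simp_all add: start rec lessThan_4_sum transition_matrix_def algebra_simps)
  have p0: "p0 = 1 - 2 * p - r" using assms(2) by simp
  have F1: "F n 1 = F n 0 + E n" for n by (simp add: E_def)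
  have S: "F (Suc n) 0 = a * F n 0 + (e * p * (1 - \<phi>)) * E n" for n
    using assms(1) unfolding rec unfolding lessThan_4_sum F1 F2 start
    by (auto simp: transition_matrix_def noise_factor_def e_def a_def p0 algebra_simps)
  have "F (Suc n) 1 - F (Suc n) 0 = (e * \<Delta> * (1 - \<phi>)) * F n 0 + d * E n" for n
    using assms(1) unfolding rec unfolding lessThan_4_sum F1 F2 start
    by (auto simp: transition_matrix_def noise_factor_def e_def d_def p0 algebra_simps)
  then have E: "E (Suc n) = (e * \<Delta> * (1 - \<phi>)) * F n 0 + d * E n" for n
    unfolding E_def[of "Suc n"] .
  have "(e * p * (1 - \<phi>)) * (e * \<Delta> * (1 - \<phi>)) = (e * e) * (p * \<Delta> * (1 - \<phi>)\<^sup>2)"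
    by (simp add: power2_eq_square algebra_simps)
  then have bc: "(e * p * (1 - \<phi>)) * (e * \<Delta> * (1 - \<phi>)) = p * \<Delta> * (1 - \<phi>)\<^sup>2"
    by (simp add: e)
  \<comment> \<open>The second summand is strictly positive, so the two eigenvalues are
    distinct.\<close>
  have "(a - d)\<^sup>2 + 4 * p * \<Delta> * (1 - \<phi>)\<^sup>2 > 0"
    using assms(3-5) by (intro add_nonneg_pos) auto
  then have "q > 0" "q\<^sup>2 = (a - d)\<^sup>2 + 4 * ((e * p * (1 - \<phi>)) * (e * \<Delta> * (1 - \<phi>)))"
    unfolding bc by (simp_all add: q_def mult.assoc)
  from coupled_recursion_closed_form[of "\<lambda>n. F n 0" E, OF _ _ S E this] show ?thesis
    by (simp add: start E_def flip: F_def)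
qed

text \<open>Here \<open>l - 1\<close> is asymptotically \<open>c * \<tau>\<close>, so
  \<open>n * ln l\<close> has the same limit as \<open>n * (l - 1)\<close>, namely
  \<open>c * t\<close>.\<close>

lemma tendsto_power_exp:
  fixes l \<tau> :: "nat \<Rightarrow> real" and n :: "nat \<Rightarrow> nat"
  assumes "\<tau> \<longlonglongrightarrow> 0" "\<And>k. \<tau> k > 0" "(\<lambda>k. real (n k) * \<tau> k) \<longlonglongrightarrow> t"
    and l: "(\<lambda>k. (l k - 1) / \<tau> k) \<longlonglongrightarrow> c"
  shows "(\<lambda>k. l k ^ n k) \<longlonglongrightarrow> exp (c * t)"
proof -
  define x where "x k = l k - 1" for k
  have "(\<lambda>k. (l k - 1) / \<tau> k * \<tau> k) \<longlonglongrightarrow> c * 0"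
    by (intro tendsto_mult l assms)
  then have x: "x \<longlonglongrightarrow> 0"
    using assms(2)[THEN less_imp_neq] by (simp add: x_def[abs_def])
  then have small: "eventually (\<lambda>k. \<bar>x k\<bar> < 1/2) sequentially"
    using order_tendstoD(2)[OF tendsto_rabs[OF x], of "1/2"] by simp
  \<comment> \<open>The quadratic error of the logarithm is arranged into factors that all converge,
    the last one to 0.\<close>
  have bound: "eventually (\<lambda>k. norm (real (n k) * ln (1 + x k) - real (n k) * x k)
      \<le> 2 * (real (n k) * \<tau> k) * \<bar>x k / \<tau> k\<bar> * \<bar>x k\<bar>) sequentially"
    using small
  proof eventually_elim
    case (elim k)
    have "norm (real (n k) * ln (1 + x k) - real (n k) * x k) = real (n k) * \<bar>ln (1 + x k) - x k\<bar>"
      by (simp add: abs_mult right_diff_distrib[symmetric])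
    also have "\<dots> \<le> real (n k) * (2 * (x k)\<^sup>2)"
      using abs_ln_one_plus_x_minus_x_bound[of "x k"] elim by (intro mult_left_mono) auto
    also have "\<dots> = 2 * (real (n k) * \<tau> k) * \<bar>x k / \<tau> k\<bar> * \<bar>x k\<bar>"
      using assms(2)[of k] by (simp add: abs_divide power2_eq_square)
    finally show ?case .
  qed
  \<comment> \<open>The base is positive once \<open>x k\<close> is small, and only then is the
    power the exponential of a logarithm.\<close>
  have pw: "eventually (\<lambda>k. exp (real (n k) * ln (1 + x k)) = l k ^ n k) sequentially"
    using small
  proof eventually_elim
    case (elim k)
    then have "l k > 0" by (simp add: x_def abs_if split: if_splits)
    then show ?case by (simp add: x_def exp_of_nat_mult)
  qed
  have "(\<lambda>k. 2 * (real (n k) * \<tau> k) * \<bar>x k / \<tau> k\<bar> * \<bar>x k\<bar>) \<longlonglongrightarrow> 2 * t * \<bar>c\<bar> * \<bar>0\<bar>"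
    by (intro tendsto_intros x assms(3) l[folded x_def])
  then have "(\<lambda>k. real (n k) * ln (1 + x k) - real (n k) * x k) \<longlonglongrightarrow> 0"
    by (intro Lim_null_comparison[OF bound]) simp
  moreover have "(\<lambda>k. real (n k) * x k) \<longlonglongrightarrow> c * t"
  proof -
    have "(\<lambda>k. (l k - 1) / \<tau> k * (real (n k) * \<tau> k)) \<longlonglongrightarrow> c * t"
      by (intro tendsto_mult l assms)
    moreover have "(l k - 1) / \<tau> k * (real (n k) * \<tau> k) = real (n k) * x k" for k
      using assms(2)[of k] by (simp add: x_def)
    ultimately show ?thesis by simp
  qed
  ultimately have "(\<lambda>k. real (n k) * ln (1 + x k) - real (n k) * x k + real (n k) * x k) \<longlonglongrightarrow> 0 + c * t"
    by (intro tendsto_add)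
  then have "(\<lambda>k. exp (real (n k) * ln (1 + x k))) \<longlonglongrightarrow> exp (c * t)"
    by (intro tendsto_exp) simp
  then show ?thesis
    by (rule Lim_transform_eventually) (rule pw)
qed

section \<open>The stroboscopic limit\<close>

lemma frac_exp_limit: "((\<lambda>\<tau>::real. (1 - exp (- 2 * \<gamma> * \<tau>)) / \<tau>) \<longlongrightarrow> 2 * \<gamma>) (at_right 0)"
  by real_asymp

text \<open>This is the first-order behaviour of the diagonal entry
  \<open>d = \<Delta> * (1 + \<phi>)\<close> of the recursion matrix.\<close>

lemma damping_limit:
  "((\<lambda>\<tau>::real. (exp (- \<kappa> * \<tau>) / 2 * (1 + exp (- 2 * \<gamma> * \<tau>)) - 1) / \<tau>) \<longlongrightarrow> - \<kappa> - \<gamma>) (at_right 0)"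
  by real_asymp

text \<open>This is the constant \<open>K\<close> inside \<open>limit_eigenvalue\<close>, half the
  gap between the two decay rates of the limiting linear system.\<close>

definition memory_rate :: "real \<Rightarrow> real \<Rightarrow> real" where
  "memory_rate \<gamma> \<kappa> = sqrt (\<kappa>\<^sup>2 + 4 * \<gamma>\<^sup>2) / 2"

lemma memory_rate_pos: "\<gamma> > 0 \<Longrightarrow> memory_rate \<gamma> \<kappa> > 0"
  by (simp add: memory_rate_def add_nonneg_pos)

lemma memory_rate_square: "(memory_rate \<gamma> \<kappa>)\<^sup>2 = \<kappa>\<^sup>2 / 4 + \<gamma>\<^sup>2"
  by (simp add: memory_rate_def power_divide)

lemma limit_eigenvalue_eq:
  "limit_eigenvalue \<gamma> \<kappa> t = exp (- (\<gamma> + \<kappa> / 2) * t) *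
    (cosh (memory_rate \<gamma> \<kappa> * t) + \<kappa> / (2 * memory_rate \<gamma> \<kappa>) * sinh (memory_rate \<gamma> \<kappa> * t))"
  by (simp add: limit_eigenvalue_def memory_rate_def Let_def)

text \<open>To first order in \<tau> the recursion matrix is the identity plus \<tau> times a
  generator with eigenvalues \<open>- (\<gamma> + \<kappa> / 2) + K\<close> and
  \<open>- (\<gamma> + \<kappa> / 2) - K\<close>. The limits of \<open>p\<close> and
  \<open>r\<close> suffice, since wherever they occur they are multiplied by powers of
  \<open>1 - \<phi>\<close>.\<close>

lemma weight_sum_transverse_limit:
  fixes \<gamma> \<kappa> :: real and p\<^sub>0 p r \<Delta> :: "real \<Rightarrow> real"
  assumes "\<gamma> > 0"
    and \<Delta>: "\<And>\<tau>. \<Delta> \<tau> = exp (- \<kappa> * \<tau>) / 2"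
    and pos: "\<And>\<tau>. \<tau> > 0 \<Longrightarrow> p \<tau> > 0"
    and total: "\<And>\<tau>. \<tau> > 0 \<Longrightarrow> p\<^sub>0 \<tau> + 2 * p \<tau> + r \<tau> = 1"
    and p: "(p \<longlongrightarrow> 1 / 2) (at_right 0)" and r: "(r \<longlongrightarrow> 0) (at_right 0)"
    and \<tau>: "\<tau> \<longlonglongrightarrow> 0" "\<And>k. \<tau> k > 0" and n: "(\<lambda>k. real (n k) * \<tau> k) \<longlonglongrightarrow> t"
    and j: "j = 1 \<or> j = 2"
  shows "(\<lambda>k. weight_sum (transition_matrix (\<Delta> (\<tau> k)) (p\<^sub>0 (\<tau> k)) (p (\<tau> k)) (r (\<tau> k)))
      (noise_factor (exp (- 2 * \<gamma> * \<tau> k)) j) (n k) 0) \<longlonglongrightarrow> limit_eigenvalue \<gamma> \<kappa> t"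
proof -
  define \<phi> where "\<phi> s = exp (- 2 * \<gamma> * s)" for s :: real
  define a where "a s = 1 - (1 - \<phi> s) * (p s + r s)" for s
  define d where "d s = \<Delta> s * (1 + \<phi> s)" for s
  define q where "q s = sqrt ((a s - d s)\<^sup>2 + 4 * p s * \<Delta> s * (1 - \<phi> s)\<^sup>2)" for s
  define K where "K = memory_rate \<gamma> \<kappa>"
  have K: "K > 0" using memory_rate_pos[OF assms(1)] by (simp add: K_def)
  have pos_ev: "eventually (\<lambda>s::real. s > 0) (at_right 0)"
    by (rule eventually_at_right_less)
  have u: "((\<lambda>s. (1 - \<phi> s) / s) \<longlongrightarrow> 2 * \<gamma>) (at_right 0)"
    unfolding \<phi>_def by (rule frac_exp_limit)
  have lim_a: "((\<lambda>s. (a s - 1) / s) \<longlongrightarrow> - \<gamma>) (at_right 0)"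
  proof -
    have "((\<lambda>s. - ((1 - \<phi> s) / s * (p s + r s))) \<longlongrightarrow> - (2 * \<gamma> * (1 / 2 + 0))) (at_right 0)"
      by (intro tendsto_intros u p r)
    then show ?thesis by (simp add: a_def)
  qed
  have lim_d: "((\<lambda>s. (d s - 1) / s) \<longlongrightarrow> - \<kappa> - \<gamma>) (at_right 0)"
    unfolding d_def \<phi>_def \<Delta> by (rule damping_limit)
  have \<Delta>_lim: "(\<Delta> \<longlongrightarrow> 1 / 2) (at_right 0)"
    unfolding \<Delta>[abs_def] by real_asymp
  \<comment> \<open>Dividing by \<open>s > 0\<close> inside the root leaves only quantities with
    known limits.\<close>
  have lim_q: "((\<lambda>s. q s / s) \<longlongrightarrow> 2 * K) (at_right 0)"
  proof -
    have "((\<lambda>s. sqrt (((a s - 1) / s - (d s - 1) / s)\<^sup>2 + 4 * p s * \<Delta> s * ((1 - \<phi> s) / s)\<^sup>2))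
        \<longlongrightarrow> sqrt ((- \<gamma> - (- \<kappa> - \<gamma>))\<^sup>2 + 4 * (1 / 2) * (1 / 2) * (2 * \<gamma>)\<^sup>2)) (at_right 0)"
      by (intro tendsto_intros lim_a lim_d u p \<Delta>_lim)
    also have "sqrt ((- \<gamma> - (- \<kappa> - \<gamma>))\<^sup>2 + 4 * (1 / 2) * (1 / 2) * (2 * \<gamma>)\<^sup>2) = 2 * K"
      by (simp add: K_def memory_rate_def power_mult_distrib)
    finally show ?thesis
    proof (rule Lim_transform_eventually)
      show "eventually (\<lambda>s. sqrt (((a s - 1) / s - (d s - 1) / s)\<^sup>2 + 4 * p s * \<Delta> s * ((1 - \<phi> s) / s)\<^sup>2)
          = q s / s) (at_right 0)"
        using pos_ev
      proof eventually_elim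
        case (elim s)
        have "((a s - 1) / s - (d s - 1) / s)\<^sup>2 + 4 * p s * \<Delta> s * ((1 - \<phi> s) / s)\<^sup>2
          = ((a s - d s)\<^sup>2 + 4 * p s * \<Delta> s * (1 - \<phi> s)\<^sup>2) / s\<^sup>2"
          by (simp add: diff_divide_distrib[symmetric] power_divide add_divide_distrib)
        then show ?case
          using elim by (simp add: q_def real_sqrt_divide)
      qed
    qed
  qed
  define l where "l s = (a s + d s + q s) / 2" for s
  define k where "k s = (a s + d s - q s) / 2" for s
  have lim_l: "((\<lambda>s. (l s - 1) / s) \<longlongrightarrow> - (\<gamma> + \<kappa> / 2) + K) (at_right 0)"
  proof -
    have "((\<lambda>s. ((a s - 1) / s + (d s - 1) / s + q s / s) / 2) \<longlongrightarrow> (- \<gamma> + (- \<kappa> - \<gamma>) + 2 * K) / 2) (at_right 0)"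
      by (intro tendsto_intros lim_a lim_d lim_q) auto
    also have "(\<lambda>s. ((a s - 1) / s + (d s - 1) / s + q s / s) / 2) = (\<lambda>s. (l s - 1) / s)"
      by (simp add: l_def add_divide_distrib diff_divide_distrib fun_eq_iff)
    finally show ?thesis by (simp add: field_simps)
  qed
  have lim_k: "((\<lambda>s. (k s - 1) / s) \<longlongrightarrow> - (\<gamma> + \<kappa> / 2) - K) (at_right 0)"
  proof -
    have "((\<lambda>s. ((a s - 1) / s + (d s - 1) / s - q s / s) / 2) \<longlongrightarrow> (- \<gamma> + (- \<kappa> - \<gamma>) - 2 * K) / 2) (at_right 0)"
      by (intro tendsto_intros lim_a lim_d lim_q) auto
    also have "(\<lambda>s. ((a s - 1) / s + (d s - 1) / s - q s / s) / 2) = (\<lambda>s. (k s - 1) / s)"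
      by (simp add: k_def add_divide_distrib diff_divide_distrib fun_eq_iff)
    finally show ?thesis by (simp add: field_simps)
  qed
  have at_right: "filterlim \<tau> (at_right 0) sequentially"
    using \<tau>(1) \<tau>(2)[THEN less_imp_neq, THEN not_sym] \<tau>(2) by (auto simp: filterlim_at)
  note seq = filterlim_compose[OF _ at_right]
  \<comment> \<open>Coefficients and gap all vanish with \<tau>, so numerator and denominator of the
    closed form are divided by \<tau> first.\<close>
  have "(\<lambda>i. (((a (\<tau> i) - 1) / \<tau> i - (k (\<tau> i) - 1) / \<tau> i) * l (\<tau> i) ^ n i
      + ((l (\<tau> i) - 1) / \<tau> i - (a (\<tau> i) - 1) / \<tau> i) * k (\<tau> i) ^ n i) / (q (\<tau> i) / \<tau> i))
    \<longlonglongrightarrow> ((- \<gamma> - (- (\<gamma> + \<kappa> / 2) - K)) * exp ((- (\<gamma> + \<kappa> / 2) + K) * t)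
      + ((- (\<gamma> + \<kappa> / 2) + K) - - \<gamma>) * exp ((- (\<gamma> + \<kappa> / 2) - K) * t)) / (2 * K)"
    using K by (intro tendsto_intros seq[OF lim_a] seq[OF lim_k] seq[OF lim_l] seq[OF lim_q]
      tendsto_power_exp[OF \<tau> n] ) auto
  also have "((- \<gamma> - (- (\<gamma> + \<kappa> / 2) - K)) * exp ((- (\<gamma> + \<kappa> / 2) + K) * t)
      + ((- (\<gamma> + \<kappa> / 2) + K) - - \<gamma>) * exp ((- (\<gamma> + \<kappa> / 2) - K) * t)) / (2 * K) = limit_eigenvalue \<gamma> \<kappa> t"
  proof -
    have "exp ((- (\<gamma> + \<kappa> / 2) + K) * t) = exp (- (\<gamma> + \<kappa> / 2) * t) * (cosh (K * t) + sinh (K * t))"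
      by (simp add: cosh_plus_sinh distrib_right flip: exp_add)
    moreover have "exp ((- (\<gamma> + \<kappa> / 2) - K) * t) = exp (- (\<gamma> + \<kappa> / 2) * t) * (cosh (K * t) - sinh (K * t))"
      by (simp add: cosh_minus_sinh left_diff_distrib flip: exp_add)
    ultimately show ?thesis
      using K by (simp add: limit_eigenvalue_eq flip: K_def) (simp add: field_simps)
  qed
  also have "(\<lambda>i. (((a (\<tau> i) - 1) / \<tau> i - (k (\<tau> i) - 1) / \<tau> i) * l (\<tau> i) ^ n i
      + ((l (\<tau> i) - 1) / \<tau> i - (a (\<tau> i) - 1) / \<tau> i) * k (\<tau> i) ^ n i) / (q (\<tau> i) / \<tau> i)) =
    (\<lambda>i. weight_sum (transition_matrix (\<Delta> (\<tau> i)) (p\<^sub>0 (\<tau> i)) (p (\<tau> i)) (r (\<tau> i)))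
      (noise_factor (exp (- 2 * \<gamma> * \<tau> i)) j) (n i) 0)" (is "?L = ?R")
  proof
    fix i
    have i: "\<tau> i > 0" by (rule \<tau>)
    have "?R i = ((a (\<tau> i) - k (\<tau> i)) * l (\<tau> i) ^ n i + (l (\<tau> i) - a (\<tau> i)) * k (\<tau> i) ^ n i) / q (\<tau> i)"
      using weight_sum_transverse[OF j total[OF i] pos[OF i], of "\<Delta> (\<tau> i)" "\<phi> (\<tau> i)" "n i"] i assms(1)
      by (simp add: \<Delta> \<phi>_def a_def d_def q_def l_def k_def)
    also have "\<dots> = ?L i"
      using i by (simp add: diff_divide_distrib[symmetric] add_divide_distrib[symmetric])
    finally show "?L i = ?R i" by simp
  qed
  finally show ?thesis .
qed

lemma weight_sum_third_limit:
  fixes \<gamma> :: real and p\<^sub>0 p r \<Delta> :: "real \<Rightarrow> real"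
  assumes total: "\<And>\<tau>. \<tau> > 0 \<Longrightarrow> p\<^sub>0 \<tau> + 2 * p \<tau> + r \<tau> = 1"
    and p: "(p \<longlongrightarrow> 1 / 2) (at_right 0)"
    and \<tau>: "\<tau> \<longlonglongrightarrow> 0" "\<And>k. \<tau> k > 0" and n: "(\<lambda>k. real (n k) * \<tau> k) \<longlonglongrightarrow> t"
  shows "(\<lambda>k. weight_sum (transition_matrix (\<Delta> (\<tau> k)) (p\<^sub>0 (\<tau> k)) (p (\<tau> k)) (r (\<tau> k)))
      (noise_factor (exp (- 2 * \<gamma> * \<tau> k)) 3) (n k) 0) \<longlonglongrightarrow> exp (- 2 * \<gamma> * t)"
  unfolding weight_sum_third
proof (rule tendsto_power_exp[OF \<tau> n])
  have at_right: "filterlim \<tau> (at_right 0) sequentially"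
    using \<tau>(1) \<tau>(2)[THEN less_imp_neq, THEN not_sym] \<tau>(2) by (auto simp: filterlim_at)
  have "((\<lambda>s. - 2 * p s * ((1 - exp (- 2 * \<gamma> * s)) / s)) \<longlongrightarrow> - 2 * (1 / 2) * (2 * \<gamma>)) (at_right 0)"
    by (intro tendsto_intros frac_exp_limit p)
  from filterlim_compose[OF this at_right]
  have "(\<lambda>k. - 2 * p (\<tau> k) * ((1 - exp (- 2 * \<gamma> * \<tau> k)) / \<tau> k)) \<longlonglongrightarrow> - 2 * \<gamma>"
    by simp
  \<comment> \<open>Normalisation turns the base minus 1 into
    \<open>- 2 * p * (1 - \<phi>)\<close>.\<close>
  moreover have "(p\<^sub>0 (\<tau> k) + 2 * p (\<tau> k) * exp (- 2 * \<gamma> * \<tau> k) + r (\<tau> k) - 1) / \<tau> k =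
      - 2 * p (\<tau> k) * ((1 - exp (- 2 * \<gamma> * \<tau> k)) / \<tau> k)" for k
  proof -
    have "p\<^sub>0 (\<tau> k) = 1 - 2 * p (\<tau> k) - r (\<tau> k)" using total[OF \<tau>(2)[of k]] by simp
    then show ?thesis by (simp add: algebra_simps)
  qed
  ultimately show "(\<lambda>k. (p\<^sub>0 (\<tau> k) + 2 * p (\<tau> k) * exp (- 2 * \<gamma> * \<tau> k) + r (\<tau> k) - 1) / \<tau> k)
      \<longlonglongrightarrow> - 2 * \<gamma>"
    by simp
qed

section \<open>The memory equation\<close>

text \<open>This closed form of the memory integral, justified in \<open>memory_integral\<close>,
  makes its sign and derivative directly accessible.\<close>

definition memory_term :: "real \<Rightarrow> real \<Rightarrow> real \<Rightarrow> real" where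
  "memory_term \<gamma> \<kappa> t =
     exp (- (\<gamma> + \<kappa> / 2) * t) * (\<gamma> / memory_rate \<gamma> \<kappa> * sinh (memory_rate \<gamma> \<kappa> * t))"

lemma initial_values: "limit_eigenvalue \<gamma> \<kappa> 0 = 1" "memory_term \<gamma> \<kappa> 0 = 0"
  by (simp_all add: limit_eigenvalue_eq memory_term_def)

lemma limit_eigenvalue_has_derivative:
  assumes "\<gamma> > 0"
  shows "(limit_eigenvalue \<gamma> \<kappa> has_real_derivative
    - \<gamma> * limit_eigenvalue \<gamma> \<kappa> t + \<gamma> * memory_term \<gamma> \<kappa> t) (at t within S)"
proof -
  define K where "K = memory_rate \<gamma> \<kappa>"
  have K: "K > 0" "K\<^sup>2 = \<kappa>\<^sup>2 / 4 + \<gamma>\<^sup>2"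
    using memory_rate_pos[OF assms] memory_rate_square by (simp_all add: K_def)
  \<comment> \<open>The relation between \<open>K\<close>, \<gamma> and \<kappa> is used here; the
    remaining identity is linear in \<open>cosh\<close> and \<open>sinh\<close>.\<close>
  have "\<gamma> * (\<gamma> / K) = K - \<kappa>\<^sup>2 / (4 * K)"
    using K by (simp add: field_simps power2_eq_square)
  then have *: "\<gamma> * (\<gamma> / K * x) = (K - \<kappa>\<^sup>2 / (4 * K)) * x" for x
    by (metis mult.assoc)
  have **: "- (\<gamma> + \<kappa> / 2) * (c + \<kappa> / (2 * K) * s) + K * s + \<kappa> / 2 * c =
      - \<gamma> * (c + \<kappa> / (2 * K) * s) + \<gamma> * (\<gamma> / K * s)" for c s
    unfolding * using K(1) by (simp add: field_simps power2_eq_square)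
  have "((\<lambda>t. exp (- (\<gamma> + \<kappa> / 2) * t) * (cosh (K * t) + \<kappa> / (2 * K) * sinh (K * t))) has_real_derivative
     exp (- (\<gamma> + \<kappa> / 2) * t) * (- (\<gamma> + \<kappa> / 2) * (cosh (K * t) + \<kappa> / (2 * K) * sinh (K * t))
       + K * sinh (K * t) + \<kappa> / 2 * cosh (K * t))) (at t within S)"
    using K(1) by (auto intro!: derivative_eq_intros simp: field_simps)
  also have "exp (- (\<gamma> + \<kappa> / 2) * t) * (- (\<gamma> + \<kappa> / 2) * (cosh (K * t) + \<kappa> / (2 * K) * sinh (K * t))
       + K * sinh (K * t) + \<kappa> / 2 * cosh (K * t)) =
     exp (- (\<gamma> + \<kappa> / 2) * t) * (- \<gamma> * (cosh (K * t) + \<kappa> / (2 * K) * sinh (K * t))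
       + \<gamma> * (\<gamma> / K * sinh (K * t)))"
    by (simp only: **)
  also have "\<dots> = - \<gamma> * limit_eigenvalue \<gamma> \<kappa> t + \<gamma> * memory_term \<gamma> \<kappa> t"
    by (simp add: limit_eigenvalue_eq memory_term_def K_def algebra_simps)
  finally show ?thesis
    by (simp add: limit_eigenvalue_eq[abs_def] K_def)
qed

lemma memory_term_has_derivative:
  assumes "\<gamma> > 0"
  shows "(memory_term \<gamma> \<kappa> has_real_derivative
    \<gamma> * limit_eigenvalue \<gamma> \<kappa> t - (\<kappa> + \<gamma>) * memory_term \<gamma> \<kappa> t) (at t within S)"
  using memory_rate_pos[OF assms, of \<kappa>]
  unfolding memory_term_def[abs_def] limit_eigenvalue_eq
  by (auto intro!: derivative_eq_intros simp: field_simps)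

section \<open>Signs, monotonicity and bounds\<close>

lemma memory_term_nonneg:
  assumes "\<gamma> > 0" "t \<ge> 0"
  shows "memory_term \<gamma> \<kappa> t \<ge> 0"
  using assms memory_rate_pos[OF assms(1), of \<kappa>] by (simp add: memory_term_def)

lemma limit_eigenvalue_pos:
  assumes "\<gamma> > 0" "\<kappa> \<ge> 0" "t \<ge> 0"
  shows "limit_eigenvalue \<gamma> \<kappa> t > 0"
  using assms memory_rate_pos[OF assms(1), of \<kappa>]
  by (simp add: limit_eigenvalue_eq add_pos_nonneg cosh_real_pos)

lemma memory_term_le_limit_eigenvalue:
  assumes "\<gamma> > 0" "\<kappa> \<ge> 0" "t \<ge> 0"
  shows "memory_term \<gamma> \<kappa> t \<le> limit_eigenvalue \<gamma> \<kappa> t"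
proof -
  define K where "K = memory_rate \<gamma> \<kappa>"
  have K: "K > 0" "K\<^sup>2 = \<kappa>\<^sup>2 / 4 + \<gamma>\<^sup>2"
    using memory_rate_pos[OF assms(1)] memory_rate_square by (simp_all add: K_def)
  have "\<gamma> \<le> K"
    by (rule power2_le_imp_le) (use K in auto)
  then have "\<gamma> / K * sinh (K * t) \<le> 1 * sinh (K * t)"
    using K assms by (intro mult_right_mono) auto
  also have "sinh (K * t) \<le> cosh (K * t)"
    using sinh_less_cosh_real by (simp add: less_imp_le)
  also have "cosh (K * t) \<le> cosh (K * t) + \<kappa> / (2 * K) * sinh (K * t)"
    using K assms by simp
  finally show ?thesis
    unfolding limit_eigenvalue_eq memory_term_def K_def by (intro mult_left_mono) auto
qed

lemma limit_eigenvalue_antimono: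
  assumes "\<gamma> > 0" "\<kappa> \<ge> 0" "0 \<le> s" "s \<le> t"
  shows "limit_eigenvalue \<gamma> \<kappa> t \<le> limit_eigenvalue \<gamma> \<kappa> s"
proof (rule DERIV_nonpos_imp_nonincreasing[OF assms(4)])
  fix x assume "s \<le> x" "x \<le> t"
  then have "\<gamma> * memory_term \<gamma> \<kappa> x \<le> \<gamma> * limit_eigenvalue \<gamma> \<kappa> x"
    using memory_term_le_limit_eigenvalue[of \<gamma> \<kappa> x] assms by simp
  then show "\<exists>y. (limit_eigenvalue \<gamma> \<kappa> has_real_derivative y) (at x) \<and> y \<le> 0"
    using limit_eigenvalue_has_derivative[OF assms(1), of \<kappa> x UNIV] by auto
qed

text \<open>In the linear system all terms cancel from the derivative of the sum except
  \<open>- \<kappa>\<close> times the memory term.\<close>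

lemma limit_eigenvalue_add_memory_term_le_1:
  assumes "\<gamma> > 0" "\<kappa> \<ge> 0" "t \<ge> 0"
  shows "limit_eigenvalue \<gamma> \<kappa> t + memory_term \<gamma> \<kappa> t \<le> 1"
proof -
  have "limit_eigenvalue \<gamma> \<kappa> t + memory_term \<gamma> \<kappa> t \<le> limit_eigenvalue \<gamma> \<kappa> 0 + memory_term \<gamma> \<kappa> 0"
  proof (rule DERIV_nonpos_imp_nonincreasing[OF assms(3)])
    fix x :: real assume "0 \<le> x"
    have "((\<lambda>x. limit_eigenvalue \<gamma> \<kappa> x + memory_term \<gamma> \<kappa> x) has_real_derivative - \<kappa> * memory_term \<gamma> \<kappa> x) (at x)"
      by (rule derivative_eq_intros limit_eigenvalue_has_derivative memory_term_has_derivative assms refl)+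
        (simp add: algebra_simps)
    then show "\<exists>y. ((\<lambda>x. limit_eigenvalue \<gamma> \<kappa> x + memory_term \<gamma> \<kappa> x) has_real_derivative y) (at x) \<and> y \<le> 0"
      using memory_term_nonneg[OF assms(1) \<open>0 \<le> x\<close>, of \<kappa>] assms(2) by auto
  qed
  then show ?thesis by (simp add: initial_values)
qed

text \<open>This is nonnegativity of the Kraus weight of \<open>pauli 3\<close> for the limit
  dynamics.\<close>

lemma limit_eigenvalue_upper_bound:
  assumes "\<gamma> > 0" "\<kappa> \<ge> 0" "t \<ge> 0"
  shows "2 * limit_eigenvalue \<gamma> \<kappa> t \<le> 1 + exp (- 2 * \<gamma> * t)"
proof -
  \<comment> \<open>Half the difference of the two sides, scaled by
    \<open>exp (2 * \<gamma> * t)\<close>: it vanishes at 0, and its derivative is a positive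
    multiple of 1 minus the sum bounded before.\<close>
  let ?X = "\<lambda>t. (1 + exp (2 * \<gamma> * t)) / 2 - exp (2 * \<gamma> * t) * limit_eigenvalue \<gamma> \<kappa> t"
  have "?X 0 \<le> ?X t"
  proof (rule DERIV_nonneg_imp_nondecreasing[OF assms(3)])
    fix x :: real assume "0 \<le> x"
    have "(?X has_real_derivative \<gamma> * exp (2 * \<gamma> * x) * (1 - (limit_eigenvalue \<gamma> \<kappa> x + memory_term \<gamma> \<kappa> x))) (at x)"
      by (auto intro!: derivative_eq_intros limit_eigenvalue_has_derivative assms simp: algebra_simps)
    then show "\<exists>y. (?X has_real_derivative y) (at x) \<and> 0 \<le> y"
      using limit_eigenvalue_add_memory_term_le_1[OF assms(1,2) \<open>0 \<le> x\<close>] assms(1) by fastforce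
  qed
  then have "exp (2 * \<gamma> * t) * (2 * limit_eigenvalue \<gamma> \<kappa> t) \<le> exp (2 * \<gamma> * t) * (1 + exp (- 2 * \<gamma> * t))"
    by (simp add: initial_values distrib_left flip: exp_add)
  then show ?thesis by simp
qed

text \<open>Variation of constants: the kernel times the memory term has \<gamma> times the
  integrand as derivative in \<open>s\<close>, and its boundary value at 0 vanishes.\<close>

lemma memory_integral:
  assumes "\<gamma> > 0" "t \<ge> 0"
  shows "\<gamma> * integral {0..t} (\<lambda>s. exp (- (\<kappa> + \<gamma>) * (t - s)) * limit_eigenvalue \<gamma> \<kappa> s) = memory_term \<gamma> \<kappa> t"
proof -
  have "((\<lambda>s. exp (- (\<kappa> + \<gamma>) * (t - s)) * memory_term \<gamma> \<kappa> s) has_real_derivative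
      \<gamma> * (exp (- (\<kappa> + \<gamma>) * (t - s)) * limit_eigenvalue \<gamma> \<kappa> s)) (at s within {0..t})" for s
    by (auto intro!: derivative_eq_intros memory_term_has_derivative assms simp: algebra_simps)
  then have "((\<lambda>s. \<gamma> * (exp (- (\<kappa> + \<gamma>) * (t - s)) * limit_eigenvalue \<gamma> \<kappa> s)) has_integral
      exp (- (\<kappa> + \<gamma>) * (t - t)) * memory_term \<gamma> \<kappa> t - exp (- (\<kappa> + \<gamma>) * (t - 0)) * memory_term \<gamma> \<kappa> 0) {0..t}"
    by (intro fundamental_theorem_of_calculus assms)
      (simp add: has_real_derivative_iff_has_vector_derivative)
  then show ?thesis
    by (simp add: initial_values integral_unique flip: integral_mult_right)
qed

lemma solves_memory_equation_limit_eigenvalue: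
  assumes "\<gamma> > 0"
  shows "solves_memory_equation \<gamma> \<kappa> (limit_eigenvalue \<gamma> \<kappa>)"
proof -
  have "\<gamma>\<^sup>2 * integral {0..t} (\<lambda>s. exp (- (\<kappa> + \<gamma>) * (t - s)) * limit_eigenvalue \<gamma> \<kappa> s) = \<gamma> * memory_term \<gamma> \<kappa> t"
    if "t \<ge> 0" for t
    using memory_integral[OF assms that, of \<kappa>] by (simp add: power2_eq_square)
  then show ?thesis
    using limit_eigenvalue_has_derivative[OF assms]
    by (simp add: solves_memory_equation_def initial_values)
qed

text \<open>Together with its memory integral \<open>g\<close>, any solution \<open>f\<close>
  satisfies the same linear system as the closed forms, with the same initial values.\<close>

lemma solves_memory_equation_unique:
  assumes "\<gamma> > 0" "\<kappa> \<ge> 0" and f: "solves_memory_equation \<gamma> \<kappa> f" and "t \<ge> 0"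
  shows "f t = limit_eigenvalue \<gamma> \<kappa> t"
proof -
  \<comment> \<open>Splitting the kernel leaves an integrand independent of the upper end point, so
    the fundamental theorem of calculus applies.\<close>
  define H where "H u = integral {0..u} (\<lambda>s. exp ((\<kappa> + \<gamma>) * s) * f s)" for u
  define g where "g u = \<gamma> * exp (- (\<kappa> + \<gamma>) * u) * H u" for u
  have integral: "\<gamma> * integral {0..u} (\<lambda>s. exp (- (\<kappa> + \<gamma>) * (u - s)) * f s) = g u" for u
  proof -
    have "integral {0..u} (\<lambda>s. exp (- (\<kappa> + \<gamma>) * (u - s)) * f s) =
        integral {0..u} (\<lambda>s. exp (- (\<kappa> + \<gamma>) * u) * (exp ((\<kappa> + \<gamma>) * s) * f s))"
      by (rule arg_cong[where f = "integral {0..u}"]) (simp add: algebra_simps fun_eq_iff flip: exp_add mult.assoc)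
    then show ?thesis by (simp add: g_def H_def)
  qed
  have f': "(f has_real_derivative - \<gamma> * f u + \<gamma> * g u) (at u within {0..})" if "u \<ge> 0" for u
    using f that by (auto simp: solves_memory_equation_def power2_eq_square mult.assoc simp flip: integral)
  then have "continuous_on {0..} f"
    by (auto simp: continuous_on_eq_continuous_within intro: DERIV_continuous)
  then have cont: "continuous_on {0..t} f"
    by (rule continuous_on_subset) auto
  have f'': "(f has_real_derivative - \<gamma> * f u + \<gamma> * g u) (at u within {0..t})" if "u \<in> {0..t}" for u
    using f'[of u] that by (auto intro: DERIV_subset)
  have "(H has_real_derivative exp ((\<kappa> + \<gamma>) * u) * f u) (at u within {0..t})" if "u \<in> {0..t}" for u
    unfolding H_def[abs_def] has_real_derivative_iff_has_vector_derivative
    by (rule integral_has_vector_derivative[OF _ that]) (intro continuous_intros cont)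
  then have g': "(g has_real_derivative \<gamma> * f u - (\<kappa> + \<gamma>) * g u) (at u within {0..t})" if "u \<in> {0..t}" for u
    unfolding g_def[abs_def] using that
    by (auto intro!: derivative_eq_intros simp: algebra_simps simp flip: exp_add)
  define x y where "x u = f u - limit_eigenvalue \<gamma> \<kappa> u" and "y u = g u - memory_term \<gamma> \<kappa> u" for u
  \<comment> \<open>the coefficient matrix of the linear system is symmetric and negative semidefinite\<close>
  have E': "((\<lambda>u. (x u)\<^sup>2 + (y u)\<^sup>2) has_real_derivative - 2 * \<gamma> * (x u - y u)\<^sup>2 - 2 * \<kappa> * (y u)\<^sup>2) (at u within {0..t})"
    if "u \<in> {0..t}" for u
    unfolding x_def y_def
    by (rule derivative_eq_intros f'' g' limit_eigenvalue_has_derivative memory_term_has_derivative that assms(1) refl)+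
      (simp add: algebra_simps power2_eq_square)
  have "(x t)\<^sup>2 + (y t)\<^sup>2 \<le> (x 0)\<^sup>2 + (y 0)\<^sup>2"
  \<comment> \<open>The derivatives within the interval are two-sided only in its interior;
    continuity covers the end points.\<close>
  proof (rule DERIV_nonpos_imp_decreasing_open[OF \<open>t \<ge> 0\<close>])
    fix u assume u: "0 < u" "u < t"
    then have "((\<lambda>u. (x u)\<^sup>2 + (y u)\<^sup>2) has_real_derivative - 2 * \<gamma> * (x u - y u)\<^sup>2 - 2 * \<kappa> * (y u)\<^sup>2) (at u)"
      using E'[of u] by (simp add: at_within_Icc_at)
    moreover have "0 \<le> \<gamma> * (x u - y u)\<^sup>2" "0 \<le> \<kappa> * (y u)\<^sup>2"
      using assms(1,2) by simp_all
    then have "- 2 * \<gamma> * (x u - y u)\<^sup>2 - 2 * \<kappa> * (y u)\<^sup>2 \<le> 0"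
      by linarith
    ultimately show "\<exists>z. ((\<lambda>u. (x u)\<^sup>2 + (y u)\<^sup>2) has_real_derivative z) (at u) \<and> z \<le> 0" by blast
  next
    show "continuous_on {0..t} (\<lambda>u. (x u)\<^sup>2 + (y u)\<^sup>2)"
      unfolding continuous_on_eq_continuous_within using E' by (blast intro: DERIV_continuous)
  qed
  also have "\<dots> = 0"
    using f by (simp add: x_def y_def g_def H_def initial_values solves_memory_equation_def)
  finally have "x t = 0"
    by (simp add: sum_power2_le_zero_iff)
  then show ?thesis by (simp add: x_def)
qed

text \<open>Clearing \<open>sinh\<close> from \<open>coth\<close> and cancelling the exponentials
  gives the quotient. At 0 the convention agrees because the memory term vanishes there.\<close>

lemma third_rate_eq:
  assumes "\<gamma> > 0" "\<kappa> \<ge> 0" "t \<ge> 0"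
  shows "third_rate \<gamma> \<kappa> t = - \<gamma> * memory_term \<gamma> \<kappa> t / limit_eigenvalue \<gamma> \<kappa> t"
proof (cases "t = 0")
  case False
  define K where "K = memory_rate \<gamma> \<kappa>"
  define s c where "s = sinh (K * t)" and "c = cosh (K * t)"
  have K: "K > 0" using memory_rate_pos[OF assms(1)] by (simp add: K_def)
  then have s: "s > 0" using False assms by (simp add: s_def)
  have c: "c > 0" by (simp add: c_def cosh_real_pos)
  have sqrt_eq: "sqrt (\<kappa>\<^sup>2 + 4 * \<gamma>\<^sup>2) = 2 * K" by (simp add: K_def memory_rate_def)
  have "third_rate \<gamma> \<kappa> t = - (2 * \<gamma>\<^sup>2) / (2 * K * (c / s) + \<kappa>)"
    using False by (simp add: third_rate_def sqrt_eq coth_def s_def c_def mult.commute)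
  also have "\<dots> = - (2 * \<gamma>\<^sup>2 * s) / (2 * K * c + \<kappa> * s)"
    using s by (simp add: field_simps)
  also have "\<dots> = - \<gamma> * (\<gamma> / K * s) / (c + \<kappa> / (2 * K) * s)"
  proof -
    have "2 * K * c + \<kappa> * s > 0" using K c s assms by (simp add: add_pos_nonneg)
    moreover have "c + \<kappa> / (2 * K) * s > 0" using K c s assms by (simp add: add_pos_nonneg)
    moreover have "K \<noteq> 0" using K by simp
    ultimately show ?thesis
      by (simp add: divide_eq_eq eq_divide_eq) (simp add: field_simps power2_eq_square)
  qed
  also have "\<dots> = - \<gamma> * memory_term \<gamma> \<kappa> t / limit_eigenvalue \<gamma> \<kappa> t"
    by (simp add: memory_term_def limit_eigenvalue_eq s_def c_def K_def)
  finally show ?thesis .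
qed (simp add: third_rate_def initial_values)

lemma third_rate_neg:
  assumes "\<gamma> > 0" "\<kappa> \<ge> 0" "t > 0"
  shows "third_rate \<gamma> \<kappa> t < 0"
proof -
  have "memory_term \<gamma> \<kappa> t > 0"
    using assms memory_rate_pos[OF assms(1), of \<kappa>] by (simp add: memory_term_def)
  then show ?thesis
    using assms limit_eigenvalue_pos[of \<gamma> \<kappa> t] by (simp add: third_rate_eq)
qed

lemma third_rate_tendsto_0:
  assumes "\<gamma> > 0" "\<kappa> \<ge> 0"
  shows "(third_rate \<gamma> \<kappa> \<longlongrightarrow> 0) (at_right 0)"
proof -
  have "isCont (memory_term \<gamma> \<kappa>) 0" "isCont (limit_eigenvalue \<gamma> \<kappa>) 0"
    using memory_term_has_derivative[OF assms(1)] limit_eigenvalue_has_derivative[OF assms(1)]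
    by (blast intro: DERIV_isCont)+
  then have "((\<lambda>t. - \<gamma> * memory_term \<gamma> \<kappa> t / limit_eigenvalue \<gamma> \<kappa> t) \<longlongrightarrow>
      - \<gamma> * memory_term \<gamma> \<kappa> 0 / limit_eigenvalue \<gamma> \<kappa> 0) (at_right 0)"
    by (intro tendsto_intros) (auto simp: initial_values isCont_def intro: tendsto_within_subset)
  then have "((\<lambda>t. - \<gamma> * memory_term \<gamma> \<kappa> t / limit_eigenvalue \<gamma> \<kappa> t) \<longlongrightarrow> 0) (at_right 0)"
    by (simp add: initial_values)
  moreover have "eventually (\<lambda>t. - \<gamma> * memory_term \<gamma> \<kappa> t / limit_eigenvalue \<gamma> \<kappa> t = third_rate \<gamma> \<kappa> t) (at_right 0)"
    using eventually_at_right_less by eventually_elim (simp add: third_rate_eq assms)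
  ultimately show ?thesis
    by (rule Lim_transform_eventually)
qed

section \<open>The limit dynamics\<close>

definition limit_multiplier :: "real \<Rightarrow> real \<Rightarrow> real \<Rightarrow> nat \<Rightarrow> real" where
  "limit_multiplier \<gamma> \<kappa> t j =
     [1, limit_eigenvalue \<gamma> \<kappa> t, limit_eigenvalue \<gamma> \<kappa> t, exp (- 2 * \<gamma> * t)] ! j"

lemma limit_multiplier_simps:
  "limit_multiplier \<gamma> \<kappa> t 0 = 1"
  "limit_multiplier \<gamma> \<kappa> t 1 = limit_eigenvalue \<gamma> \<kappa> t"
  "limit_multiplier \<gamma> \<kappa> t 2 = limit_eigenvalue \<gamma> \<kappa> t"
  "limit_multiplier \<gamma> \<kappa> t 3 = exp (- 2 * \<gamma> * t)"
  by (simp_all add: limit_multiplier_def)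

lemma limit_dynamics_eq: "limit_dynamics \<gamma> \<kappa> t = pauli_map (limit_multiplier \<gamma> \<kappa> t)"
  by (simp add: limit_dynamics_def limit_multiplier_def[abs_def])

lemma trace_preserving_limit_dynamics: "trace_preserving (limit_dynamics \<gamma> \<kappa> t)"
  by (simp add: limit_dynamics_eq trace_preserving_pauli_map limit_multiplier_simps)

text \<open>Up to the factor 1/4, weights 1 and 2 are \<open>1 - exp (- 2 * \<gamma> * t)\<close>,
  weight 0 is a sum of positive terms, and weight 3 is the upper bound shown before.\<close>

lemma completely_positive_limit_dynamics:
  assumes "\<gamma> > 0" "\<kappa> \<ge> 0" "t \<ge> 0"
  shows "completely_positive (limit_dynamics \<gamma> \<kappa> t)"
  unfolding limit_dynamics_eq
proof (rule completely_positive_pauli_map)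
  fix k :: nat assume "k < 4"
  then have "k = 0 \<or> k = 1 \<or> k = 2 \<or> k = 3" by linarith
  then show "pauli_weight (limit_multiplier \<gamma> \<kappa> t) k \<ge> 0"
    using limit_eigenvalue_pos[OF assms] limit_eigenvalue_upper_bound[OF assms] assms
    by (auto simp: pauli_weight_def limit_multiplier_def add_nonneg_nonneg)
qed

lemma P_divisible_limit_dynamics:
  assumes "\<gamma> > 0" "\<kappa> \<ge> 0"
  shows "P_divisible (limit_dynamics \<gamma> \<kappa>)"
  unfolding P_divisible_def
proof (intro allI impI)
  fix s t :: real assume st: "0 \<le> s \<and> s \<le> t"
  \<comment> \<open>The intermediate map divides the multipliers at \<open>t\<close> by those at
    \<open>s\<close>; they are positive and nonincreasing, so the ratios lie in [0, 1].\<close>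
  define \<mu> where "\<mu> j = limit_multiplier \<gamma> \<kappa> t j / limit_multiplier \<gamma> \<kappa> s j" for j
  have pos: "limit_eigenvalue \<gamma> \<kappa> s > 0" "limit_eigenvalue \<gamma> \<kappa> t > 0"
    using st assms by (auto intro: limit_eigenvalue_pos)
  have "\<bar>\<mu> j\<bar> \<le> 1" if "j \<in> {1, 2, 3}" for j
    using that pos limit_eigenvalue_antimono[of \<gamma> \<kappa> s t] st assms
    by (auto simp: \<mu>_def limit_multiplier_def)
  moreover have "\<mu> 0 = 1" by (simp add: \<mu>_def limit_multiplier_simps)
  ultimately have "positive_map (pauli_map \<mu>)"
    unfolding positive_map_def by (blast intro: mat_linear_pauli_map pos_semidef_pauli_map)
  moreover have "trace_preserving (pauli_map \<mu>)"
    by (simp add: trace_preserving_pauli_map \<mu>_def limit_multiplier_simps)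
  moreover have "limit_dynamics \<gamma> \<kappa> t = pauli_map \<mu> \<circ> limit_dynamics \<gamma> \<kappa> s"
    unfolding fun_eq_iff o_def limit_dynamics_eq pauli_map_compose
    using pos by (simp add: matrix_2_eq_iff pauli_map_entries \<mu>_def limit_multiplier_simps
      del: One_nat_def)
  ultimately show "\<exists>V. positive_map V \<and> trace_preserving V \<and>
      limit_dynamics \<gamma> \<kappa> t = V \<circ> limit_dynamics \<gamma> \<kappa> s"
    by blast
qed

text \<open>Each \<open>pauli i\<close> that anticommutes with \<open>pauli j\<close> contributes
  \<open>- g i\<close>, because conjugation changes the sign and the prefactor is 1/2.\<close>

lemma pauli_generator_pauli_map:
  "pauli_generator g (pauli_map \<mu> \<rho>) =
    pauli_map (\<lambda>j. [0, - (g 2 + g 3), - (g 1 + g 3), - (g 1 + g 2)] ! j * \<mu> j) \<rho>"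
proof -
  have "{1..3} = {1, 2, 3::nat}" by auto
  then show ?thesis
    by (simp add: pauli_generator_def matrix_2_eq_iff pauli_conjugation_entries sum_2 pauli_entries
      pauli_map_entries scaleR_conv_of_real[where 'a = complex] field_simps del: One_nat_def)
qed

lemma has_vector_derivative_pauli_map:
  assumes "\<And>j. j < 4 \<Longrightarrow> ((\<lambda>s. m s j) has_real_derivative m' j) (at t within S)"
  shows "((\<lambda>s. pauli_map (m s) \<rho>) has_vector_derivative pauli_map m' \<rho>) (at t within S)"
proof -
  \<comment> \<open>For a fixed matrix a Pauli map is linear in its multipliers, so they can be
    differentiated one by one.\<close>
  have *: "pauli_map \<mu> \<rho> = (\<Sum>j<4. \<mu> j *\<^sub>R mat_scale (trace (pauli j ** \<rho>) / 2) (pauli j))" for \<mu>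
    by (simp add: pauli_map_def mat_scale_def vec_eq_iff scaleR_conv_of_real[where 'a = complex] mult.assoc)
  show ?thesis
    unfolding * using assms
    by (intro has_vector_derivative_sum) (auto intro!: derivative_eq_intros)
qed

lemma limit_dynamics_has_vector_derivative:
  assumes "\<gamma> > 0" "\<kappa> \<ge> 0" "t \<ge> 0"
  shows "((\<lambda>s. limit_dynamics \<gamma> \<kappa> s \<rho>) has_vector_derivative
    pauli_generator (\<lambda>i. rate \<gamma> \<kappa> i t) (limit_dynamics \<gamma> \<kappa> t \<rho>)) (at t within {0..})"
  unfolding limit_dynamics_eq pauli_generator_pauli_map
proof (rule has_vector_derivative_pauli_map)
  fix j :: nat assume "j < 4"
  then have j: "j = 0 \<or> j = 1 \<or> j = 2 \<or> j = 3" by linarith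
  let ?g = "\<lambda>i. rate \<gamma> \<kappa> i t"
  \<comment> \<open>The third rate is exactly the one that accounts for the memory term in the
    derivative.\<close>
  have "- (\<gamma> + third_rate \<gamma> \<kappa> t) * limit_eigenvalue \<gamma> \<kappa> t
      = - \<gamma> * limit_eigenvalue \<gamma> \<kappa> t + \<gamma> * memory_term \<gamma> \<kappa> t"
    using limit_eigenvalue_pos[OF assms] by (simp add: third_rate_eq assms field_simps)
  then have "(limit_eigenvalue \<gamma> \<kappa> has_real_derivative
      - (\<gamma> + third_rate \<gamma> \<kappa> t) * limit_eigenvalue \<gamma> \<kappa> t) (at t within {0..})"
    using limit_eigenvalue_has_derivative[OF assms(1)] by simp
  moreover have "((\<lambda>s. exp (- 2 * \<gamma> * s)) has_real_derivative - (\<gamma> + \<gamma>) * exp (- 2 * \<gamma> * t)) (at t within {0..})"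
    by (auto intro!: derivative_eq_intros)
  ultimately show "((\<lambda>s. limit_multiplier \<gamma> \<kappa> s j) has_real_derivative
      [0, - (?g 2 + ?g 3), - (?g 1 + ?g 3), - (?g 1 + ?g 2)] ! j * limit_multiplier \<gamma> \<kappa> t j) (at t within {0..})"
    using j by (elim disjE) (simp_all add: limit_multiplier_def rate_def)
qed

theorem mainTheorem6:
  fixes \<gamma> \<kappa> :: real and p\<^sub>0 p r \<Delta> :: "real \<Rightarrow> real"
    and \<Lambda> :: "real \<Rightarrow> nat \<Rightarrow> complex^2^2 \<Rightarrow> complex^2^2"
  defines "\<Delta> \<equiv> \<lambda>\<tau>. exp (- \<kappa> * \<tau>) / 2"
    and "\<Lambda> \<equiv> \<lambda>\<tau>. discrete_dynamics (exp (- 2 * \<gamma> * \<tau>)) (\<Delta> \<tau>) (p\<^sub>0 \<tau>) (p \<tau>) (r \<tau>)"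
  assumes "\<gamma> > 0" and "\<kappa> \<ge> 0"
    and "\<And>\<tau>. \<tau> > 0 \<Longrightarrow> p\<^sub>0 \<tau> \<ge> 0"
    and "\<And>\<tau>. \<tau> > 0 \<Longrightarrow> r \<tau> \<ge> 0"
    and "\<And>\<tau>. \<tau> > 0 \<Longrightarrow> 0 \<le> \<Delta> \<tau> \<and> \<Delta> \<tau> \<le> p \<tau> \<and> p \<tau> \<le> 1 / 2"
    and "\<And>\<tau>. \<tau> > 0 \<Longrightarrow> p\<^sub>0 \<tau> + 2 * p \<tau> + r \<tau> = 1"
  shows "(p \<longlongrightarrow> 1 / 2) (at_right 0) \<and> (r \<longlongrightarrow> 0) (at_right 0) \<and>
    (\<forall>\<tau>>0. \<forall>n. (\<forall>j<4. \<Lambda> \<tau> n (pauli j) = pauli_eigenvalue (\<Lambda> \<tau> n) j *\<^sub>R pauli j) \<and>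
       pauli_eigenvalue (\<Lambda> \<tau> n) 1 = pauli_eigenvalue (\<Lambda> \<tau> n) 2) \<and>
    (\<forall>\<tau> n t. (\<forall>k. \<tau> k > 0) \<and> \<tau> \<longlonglongrightarrow> 0 \<and> filterlim n at_top sequentially \<and>
         (\<lambda>k. real (n k) * \<tau> k) \<longlonglongrightarrow> t \<longrightarrow>
       (\<lambda>k. pauli_eigenvalue (\<Lambda> (\<tau> k) (n k)) 3) \<longlonglongrightarrow> exp (- 2 * \<gamma> * t) \<and>
       (\<lambda>k. pauli_eigenvalue (\<Lambda> (\<tau> k) (n k)) 1) \<longlonglongrightarrow> limit_eigenvalue \<gamma> \<kappa> t \<and>
       (\<lambda>k. pauli_eigenvalue (\<Lambda> (\<tau> k) (n k)) 2) \<longlonglongrightarrow> limit_eigenvalue \<gamma> \<kappa> t) \<and>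
    solves_memory_equation \<gamma> \<kappa> (limit_eigenvalue \<gamma> \<kappa>) \<and>
    (\<forall>f. solves_memory_equation \<gamma> \<kappa> f \<longrightarrow> (\<forall>t\<ge>0. f t = limit_eigenvalue \<gamma> \<kappa> t)) \<and>
    (\<forall>t\<ge>0. completely_positive (limit_dynamics \<gamma> \<kappa> t) \<and> trace_preserving (limit_dynamics \<gamma> \<kappa> t)) \<and>
    P_divisible (limit_dynamics \<gamma> \<kappa>) \<and>
    (\<forall>t\<ge>0. \<forall>\<rho>. ((\<lambda>s. limit_dynamics \<gamma> \<kappa> s \<rho>) has_vector_derivative
       pauli_generator (\<lambda>i. rate \<gamma> \<kappa> i t) (limit_dynamics \<gamma> \<kappa> t \<rho>)) (at t within {0..})) \<and>
    (third_rate \<gamma> \<kappa> \<longlongrightarrow> 0) (at_right 0) \<and>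
    (\<forall>t>0. third_rate \<gamma> \<kappa> t < 0)"
proof -
  note bounds = assms(5-8)
  have ev: "eventually (\<lambda>\<tau>::real. \<tau> > 0) (at_right 0)"
    by (rule eventually_at_right_less)
  have "(\<Delta> \<longlongrightarrow> 1 / 2) (at_right 0)"
    unfolding \<Delta>_def by real_asymp
  \<comment> \<open>\<open>p\<close> is squeezed between \<Delta> and 1/2.\<close>
  then have p: "(p \<longlongrightarrow> 1 / 2) (at_right 0)"
    by (rule tendsto_sandwich[rotated 2])
      (auto intro!: eventually_mono[OF ev] dest: bounds(3))
  then have "((\<lambda>\<tau>. 1 - 2 * p \<tau>) \<longlongrightarrow> 1 - 2 * (1 / 2)) (at_right 0)"
    by (intro tendsto_intros)
  then have "((\<lambda>\<tau>. 1 - 2 * p \<tau>) \<longlongrightarrow> 0) (at_right 0)" by simp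
  \<comment> \<open>Nonnegativity of \<open>p\<^sub>0\<close> and normalisation bound
    \<open>r\<close> by \<open>1 - 2 * p\<close>.\<close>
  then have r: "(r \<longlongrightarrow> 0) (at_right 0)"
  proof (rule tendsto_sandwich[of "\<lambda>_. 0", rotated 3])
    show "eventually (\<lambda>\<tau>. r \<tau> \<le> 1 - 2 * p \<tau>) (at_right 0)"
      using ev by eventually_elim (use bounds(1,4) in fastforce)
  qed (auto intro: eventually_mono[OF ev] simp: bounds(2))
  define F where "F \<tau> j n = weight_sum (transition_matrix (\<Delta> \<tau>) (p\<^sub>0 \<tau>) (p \<tau>) (r \<tau>))
    (noise_factor (exp (- 2 * \<gamma> * \<tau>)) j) n 0" for \<tau> j n
  have \<Lambda>: "\<Lambda> \<tau> n (pauli j) = F \<tau> j n *\<^sub>R pauli j" if "j < 4" for \<tau> n j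
    unfolding \<Lambda>_def F_def by (rule discrete_dynamics_pauli[OF that])
  have eigenvalue: "pauli_eigenvalue (\<Lambda> \<tau> n) j = F \<tau> j n" if "j < 4" for \<tau> n j
    by (rule pauli_eigenvalue_eq) (use \<Lambda> that in auto)
  have \<Delta>_pos: "\<Delta> \<tau> > 0" for \<tau> by (simp add: \<Delta>_def)
  have p_pos: "p \<tau> > 0" if "\<tau> > 0" for \<tau>
    using bounds(3)[OF that] \<Delta>_pos[of \<tau>] by linarith
  \<comment> \<open>Both directions rewrite to the same closed form.\<close>
  have "F \<tau> 1 n = F \<tau> 2 n" if "\<tau> > 0" for \<tau> n
    unfolding F_def using that assms(3) \<Delta>_pos[of \<tau>]
    by (subst (1 2) weight_sum_transverse[OF _ bounds(4) p_pos]) auto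
  moreover have "(\<lambda>k. F (\<tau> k) 3 (n k)) \<longlonglongrightarrow> exp (- 2 * \<gamma> * t)"
    "(\<lambda>k. F (\<tau> k) 1 (n k)) \<longlonglongrightarrow> limit_eigenvalue \<gamma> \<kappa> t"
    "(\<lambda>k. F (\<tau> k) 2 (n k)) \<longlonglongrightarrow> limit_eigenvalue \<gamma> \<kappa> t"
    if "\<And>k. \<tau> k > 0" "\<tau> \<longlonglongrightarrow> 0" "(\<lambda>k. real (n k) * \<tau> k) \<longlonglongrightarrow> t" for \<tau> n t
  proof -
    show "(\<lambda>k. F (\<tau> k) 3 (n k)) \<longlonglongrightarrow> exp (- 2 * \<gamma> * t)"
      unfolding F_def by (rule weight_sum_third_limit[OF bounds(4) p that(2,1,3)])
    have "(\<lambda>k. F (\<tau> k) j (n k)) \<longlonglongrightarrow> limit_eigenvalue \<gamma> \<kappa> t" if "j = 1 \<or> j = 2" for j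
      unfolding F_def
      by (rule weight_sum_transverse_limit[OF assms(3) _ p_pos bounds(4) p r \<open>\<tau> \<longlonglongrightarrow> 0\<close> \<open>\<And>k. \<tau> k > 0\<close>
          \<open>(\<lambda>k. real (n k) * \<tau> k) \<longlonglongrightarrow> t\<close> that]) (simp_all add: \<Delta>_def)
    then show "(\<lambda>k. F (\<tau> k) 1 (n k)) \<longlonglongrightarrow> limit_eigenvalue \<gamma> \<kappa> t"
      "(\<lambda>k. F (\<tau> k) 2 (n k)) \<longlonglongrightarrow> limit_eigenvalue \<gamma> \<kappa> t"
      by blast+
  qed
  ultimately show ?thesis
    using p r \<Lambda> eigenvalue solves_memory_equation_limit_eigenvalue solves_memory_equation_unique
      completely_positive_limit_dynamics trace_preserving_limit_dynamics P_divisible_limit_dynamics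
      limit_dynamics_has_vector_derivative third_rate_tendsto_0 third_rate_neg assms(3,4)
    by (simp del: One_nat_def)
qed

end
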